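(* Assume that $\boldsymbol P\boldsymbol P^\top+\boldsymbol W\boldsymbol W^\top=\boldsymbol I_n$. When both $\boldsymbol\beta$ and $\sigma^2$ are unknown with prior $\pi(\boldsymbol\beta,\sigma^2\mid\boldsymbol\theta)\propto1/\sigma^2$, the predictive distribution, i.e. the distribution of $\boldsymbol y_0$ conditional to $\boldsymbol y$ and $\boldsymbol\theta$, is multivariate Student with $n-p$ degrees of freedom, location vector $$\boldsymbol E_0-\boldsymbol S_{\boldsymbol\theta,0,\boldsymbol W}\left(\boldsymbol W^\top\boldsymbol\Sigma_{\boldsymbol\theta}\boldsymbol W\right)^{-1}\boldsymbol W^\top\boldsymbol y$$ and scale matrix $$\frac{\boldsymbol y^\top\boldsymbol W\left(\boldsymbol W^\top\boldsymbol\Sigma_{\boldsymbol\theta}\boldsymbol W\right)^{-1}\boldsymbol W^\top\boldsymbol y}{n-p}\left\{\boldsymbol S_{\boldsymbol\theta,0,0}-\boldsymbol S_{\boldsymbol\theta,0,\boldsymbol W}\left(\boldsymbol W^\top\boldsymbol\Sigma_{\boldsymbol\theta}\boldsymbol W\right)^{-1}\boldsymbol S_{\boldsymbol\theta,0,\boldsymbol W}^\top\right\}.$$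
   Context: Model: $n>p$; given $\boldsymbol\beta\in\mathbb R^p$, $\sigma^2>0$ and the correlation parameter $\boldsymbol\theta$, the vector $\boldsymbol y\in\mathbb R^n$ (observed points) and $\boldsymbol y_0\in\mathbb R^{n_0}$ (unobserved points) are jointly Gaussian with means $\boldsymbol H\boldsymbol\beta$ and $\boldsymbol H_{0,0}\boldsymbol\beta$, covariances $\sigma^2\boldsymbol\Sigma_{\boldsymbol\theta}$ (of $\boldsymbol y$), $\sigma^2\boldsymbol\Sigma_{\boldsymbol\theta,0,0}$ (of $\boldsymbol y_0$), and cross-covariance $\sigma^2\boldsymbol\Sigma_{\boldsymbol\theta,0,\cdot}$ ($n_0\times n$, between $\boldsymbol y_0$ and $\boldsymbol y$), with transpose $\sigma^2\boldsymbol\Sigma_{\boldsymbol\theta,\cdot,0}$. $\boldsymbol H$ ($n\times p$, rank $p$) and $\boldsymbol H_{0,0}$ ($n_0\times p$) contain the values of the $p$ basis functions of the mean at the observed and unobserved points; $\boldsymbol\Sigma_{\boldsymbol\theta}$ is nonsingular. $\boldsymbol P$ ($n\times p$) and $\boldsymbol W$ ($n\times(n-p)$) are full-rank matrices whose columns span the column space of $\boldsymbol H$ and its orthogonal complement, respectively. Notation: $\boldsymbol H_{0,\cdot}=\boldsymbol H_{0,0}(\boldsymbol P^\top\boldsymbol H)^{-1}$, $\boldsymbol H_{\cdot,0}=\boldsymbol H_{0,\cdot}^\top$, $\boldsymbol E_0=\boldsymbol H_{0,\cdot}\boldsymbol P^\top\boldsymbol y$, $\boldsymbol S_{\boldsymbol\theta,0,0}=\boldsymbol\Sigma_{\boldsymbol\theta,0,0}+\boldsymbol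 H_{0,\cdot}\boldsymbol P^\top\boldsymbol\Sigma_{\boldsymbol\theta}\boldsymbol P\boldsymbol H_{\cdot,0}-\boldsymbol H_{0,\cdot}\boldsymbol P^\top\boldsymbol\Sigma_{\boldsymbol\theta,\cdot,0}-\boldsymbol\Sigma_{\boldsymbol\theta,0,\cdot}\boldsymbol P\boldsymbol H_{\cdot,0}$, $\boldsymbol S_{\boldsymbol\theta,0,\boldsymbol W}=(\boldsymbol H_{0,\cdot}\boldsymbol P^\top\boldsymbol\Sigma_{\boldsymbol\theta}-\boldsymbol\Sigma_{\boldsymbol\theta,0,\cdot})\boldsymbol W$ (an $n_0\times(n-p)$ matrix). Multivariate Student with $k$ degrees of freedom, location $\boldsymbol m$ and scale matrix $\boldsymbol A$: the law of $\boldsymbol m+\boldsymbol Z\sqrt{k/V}$ with $\boldsymbol Z\sim\mathcal N(0,\boldsymbol A)$ and $V\sim\chi^2_k$ independent. *)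

theory Defs
  imports "HOL-Probability.Probability"
begin

definition univariate_normal :: "real \<Rightarrow> real \<Rightarrow> real measure \<Rightarrow> bool" where
  "univariate_normal m v M \<longleftrightarrow>
     (if v = 0 then M = return borel m
      else 0 < v \<and> M = density lborel (\<lambda>x. ennreal (normal_density m (sqrt v) x)))"

(* The Gaussian law with mean m and covariance operator C on a Euclidean space: every linear
   functional is univariate normal. C may be singular. On real ^ 'n the operator is A *v _ for the
   covariance matrix A; self-adjointness is symmetry of A. Nonnegativity of u \<bullet> C u is
   part of univariate_normal. *)
definition multivariate_normal ::
  "'a::euclidean_space \<Rightarrow> ('a \<Rightarrow> 'a) \<Rightarrow> 'a measure \<Rightarrow> bool" where
  "multivariate_normal m C M \<longleftrightarrow>
     prob_space M \<and> sets M = sets borel \<and>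
     linear C \<and> (\<forall>u v. u \<bullet> C v = C u \<bullet> v) \<and>
     (\<forall>u. univariate_normal (u \<bullet> m) (u \<bullet> C u) (distr M borel (\<lambda>x. u \<bullet> x)))"

definition chi_squared :: "nat \<Rightarrow> real measure" where
  "chi_squared k = density lborel (\<lambda>v. ennreal (if v \<le> 0 then 0 else
     v powr (real k / 2 - 1) * exp (- v / 2) / (2 powr (real k / 2) * Gamma (real k / 2))))"

(* The product measure makes Z (with law N) and V independent. *)
definition multivariate_student ::
  "nat \<Rightarrow> real ^ 'm \<Rightarrow> real ^ 'm ^ 'm \<Rightarrow> (real ^ 'm) measure \<Rightarrow> bool" where
  "multivariate_student k m A M \<longleftrightarrow>
     (\<exists>N. multivariate_normal 0 (\<lambda>z. A *v z) N \<and>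
          M = distr (N \<Otimes>\<^sub>M chi_squared k) borel (\<lambda>(z, v). m + sqrt (real k / v) *\<^sub>R z))"

(* The improper prior with density c / s at (beta, s), where s stands for sigma^2 and ranges over
   the positive reals. *)
definition reference_prior :: "real \<Rightarrow> ('a::euclidean_space \<times> real) measure" where
  "reference_prior c =
     density (restrict_space lborel (UNIV \<times> {0<..})) (\<lambda>(_, s). ennreal (c / s))"

(* kappa is a regular conditional distribution of the second component given the first, under a
   possibly infinite measure Q. It determines kappa almost everywhere when the first marginal
   of Q is sigma-finite. *)
definition conditional_distribution ::
  "('a::euclidean_space \<times> 'b::euclidean_space) measure \<Rightarrow> ('a \<Rightarrow> 'b measure) \<Rightarrow> bool" where
  "conditional_distribution Q \<kappa> \<longleftrightarrow>
     \<kappa> \<in> borel \<rightarrow>\<^sub>M prob_algebra borel \<and>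
     (\<forall>A\<in>sets borel. \<forall>B\<in>sets borel.
        emeasure Q (A \<times> B) = (\<integral>\<^sup>+ y. emeasure (\<kappa> y) B * indicator A y \<partial>distr Q borel fst))"

end

theory Submission
  imports Defs
begin

text \<open>
  Write \<open>k = n - p\<close>. Under \<open>(\<beta>, s)\<close> the pair of observed and unobserved vectors is
  \<open>(H \<beta>, H00 \<beta>) + sqrt s (\<epsilon>, \<epsilon>0)\<close>, where \<open>(\<epsilon>, \<epsilon>0)\<close> has the centred Gaussian law for
  \<open>s = 1\<close>. The noise splits into three parts: \<open>\<tau> = (P\<^sup>T H)\<^sup>-\<^sup>1 P\<^sup>T \<epsilon>\<close>, the whitened residual
  \<open>\<xi> = N\<^sup>T W\<^sup>T \<epsilon>\<close>, where \<open>N N\<^sup>T = (W\<^sup>T \<Sigma> W)\<^sup>-\<^sup>1\<close>, and the error \<open>\<rho>\<close> of predicting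
  \<open>\<epsilon>0 - H0 P\<^sup>T \<epsilon>\<close> from \<open>W\<^sup>T \<epsilon>\<close> by linear regression. Then \<open>\<xi>\<close> is standard normal,
  independent of \<open>\<rho>\<close>, which has the covariance \<open>R = S00 - S0W K S0W\<^sup>T\<close>, and
  \<open>y = H (\<beta> + sqrt s \<tau>) + W x'\<close> and \<open>y0 = location y + sqrt s \<rho>\<close>, where
  \<open>x' = sqrt s W\<^sup>T \<epsilon>\<close> is a linear image of \<open>x = sqrt s \<xi>\<close>.

  Under the flat prior \<open>\<beta>\<close> is distributed according to Lebesgue measure, which is invariant under the
  translation by \<open>sqrt s \<tau>\<close>. Hence \<open>\<tau>\<close> disappears, and up to a linear change of coordinates \<open>y\<close> consists
  of a Lebesgue distributed \<open>\<beta>\<close> and the vector \<open>x\<close>. What remains is the joint law of \<open>s\<close> and \<open>x\<close>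
  under \<open>ds / s\<close>. Substituting \<open>x = sqrt s \<xi>\<close> and then \<open>s = |x|\<^sup>2 / v\<close> in the Gaussian density shows
  that \<open>x\<close> has a density proportional to \<open>|x|\<^sup>-\<^sup>k\<close> and that, given \<open>x\<close>, the variable
  \<open>v = |x|\<^sup>2 / s\<close> is chi-squared with \<open>k\<close> degrees of freedom
  (\<open>nn_integral_scale_mixture\<close>, \<open>nn_integral_location_scale_mixture\<close>). So, given \<open>y\<close>,
  \<open>y0 = location y + (|x| / sqrt v) \<rho>\<close>, with \<open>|x|\<^sup>2 = (W\<^sup>T y)\<^sup>T K (W\<^sup>T y)\<close>, which is the Student law of the
  theorem. The same formula exhibits the law of \<open>y\<close> as the image, under an injective map with a measurable
  left inverse, of a measure with a finite density. It is therefore sigma-finite, so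
  that the conditional law is determined almost everywhere.

  The Gaussian laws are given through their one-dimensional projections only. Their identification
  and the independence of \<open>\<xi>\<close> and \<open>\<rho>\<close> rest on the uniqueness theorem for characteristic
  functions in several dimensions (\<open>multivariate_char_uniqueness\<close>).
\<close>

section \<open>Uniqueness of characteristic functions in several dimensions\<close>

text \<open>
  Divided by its total mass, the law of \<open>X\<close> under the density \<open>h\<close> is a probability measure on the line,
  and the hypothesis \<open>eq\<close> compares the characteristic functions of the two laws so obtained. This reduces the
  claim to uniqueness in dimension one; when the mass is zero, both sides vanish.
\<close>

lemma weighted_distr_eqI:
  fixes X :: "'a \<Rightarrow> real" and h :: "'a \<Rightarrow> real"
  assumes M: "prob_space M" and N: "prob_space N" and sets_eq: "sets M = sets N"
    and X: "X \<in> borel_measurable M" and h: "h \<in> borel_measurable M"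
    and h0: "\<And>x. 0 \<le> h x" and hB: "\<And>x. h x \<le> B"
    and eq: "\<And>s. (CLINT x|M. h x * iexp (s * X x)) = (CLINT x|N. h x * iexp (s * X x))"
    and A: "A \<in> sets borel"
  shows "(LINT x|M. h x * indicator A (X x)) = (LINT x|N. h x * indicator A (X x))"
proof -
  interpret M: prob_space M by fact
  interpret N: prob_space N by fact
  note sets_eq[measurable_cong]
  have [measurable]: "X \<in> borel_measurable M" "h \<in> borel_measurable M"
      "X \<in> borel_measurable N" "h \<in> borel_measurable N" "A \<in> sets borel"
    using X h A sets_eq measurable_cong_sets[OF sets_eq refl] by auto
  have int: "integrable M h" "integrable N h"
    by (auto intro!: M.integrable_const_bound[where B=B] N.integrable_const_bound[where B=B]
        simp: h0 hB)
  define c where "c = (LINT x|M. h x)"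
  have c0: "0 \<le> c" unfolding c_def by (simp add: h0 integral_nonneg_AE)
  have "complex_of_real (LINT x|M. h x) = complex_of_real (LINT x|N. h x)"
    using eq[of 0] by simp
  hence cN: "(LINT x|N. h x) = c" unfolding c_def of_real_eq_iff by simp
  show ?thesis
  proof (cases "c = 0")
    case True
    have "AE x in M. h x = 0" "AE x in N. h x = 0"
      using True cN int integral_nonneg_eq_0_iff_AE[OF int(1)] integral_nonneg_eq_0_iff_AE[OF int(2)]
      by (auto simp: c_def h0)
    hence "AE x in M. h x * indicator A (X x) = (0::real)"
        "AE x in N. h x * indicator A (X x) = (0::real)" by auto
    thus ?thesis using integral_eq_zero_AE by metis
  next
    case False
    hence cp: "c > 0" using c0 by simp
    define D where "D K = distr (density K (\<lambda>x. ennreal (h x / c))) borel X" for K :: "'a measure"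
    have D: "real_distribution (D K)" "char (D K) s = (CLINT x|K. h x * iexp (s * X x)) / c"
        "measure (D K) A = (LINT x|K. h x * indicator A (X x)) / c"
      if "prob_space K" and [measurable]: "X \<in> borel_measurable K" "h \<in> borel_measurable K"
        and i: "integrable K h" and I: "(LINT x|K. h x) = c" for K s
    proof -
      interpret K: prob_space K by fact
      have "prob_space (density K (\<lambda>x. ennreal (h x / c)))"
      proof
        have "(\<integral>\<^sup>+ x. ennreal (h x / c) \<partial>K) = ennreal (LINT x|K. h x / c)"
          by (rule nn_integral_eq_integral) (use i h0 cp in auto)
        thus "emeasure (density K (\<lambda>x. ennreal (h x / c))) (space (density K (\<lambda>x. ennreal (h x / c)))) = 1"
          using I cp by (simp add: emeasure_density cong: nn_integral_cong)
      qed
      then interpret DK: prob_space "density K (\<lambda>x. ennreal (h x / c))" .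
      show R: "real_distribution (D K)"
        unfolding D_def by (intro DK.real_distribution_distr) simp
      interpret R: real_distribution "D K" by fact
      have "char (D K) s = (CLINT x|density K (\<lambda>x. ennreal (h x / c)). iexp (s * X x))"
        unfolding char_def D_def by (subst integral_distr) auto
      also have "\<dots> = (CLINT x|K. (h x / c) *\<^sub>R iexp (s * X x))"
        by (subst integral_density) (auto simp: h0 c0)
      also have "\<dots> = (CLINT x|K. (h x * iexp (s * X x)) / c)"
        by (intro Bochner_Integration.integral_cong) (auto simp: scaleR_conv_of_real)
      finally show "char (D K) s = (CLINT x|K. h x * iexp (s * X x)) / c" by simp
      have "measure (D K) A = (LINT y|D K. indicator A y)" by (simp add: D_def)
      also have "\<dots> = (LINT x|density K (\<lambda>x. ennreal (h x / c)). indicator A (X x))"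
        unfolding D_def by (subst integral_distr) auto
      also have "\<dots> = (LINT x|K. (h x / c) *\<^sub>R indicator A (X x))"
        by (subst integral_density) (auto simp: h0 c0)
      finally show "measure (D K) A = (LINT x|K. h x * indicator A (X x)) / c" by simp
    qed
    have "char (D M) = char (D N)"
      using D(2)[OF M] D(2)[OF N] int cN eq by (auto simp: c_def)
    hence "D M = D N"
      using D(1)[OF M] D(1)[OF N] int cN by (intro Levy_uniqueness) (auto simp: c_def)
    thus ?thesis using D(3)[OF M] D(3)[OF N] int cN cp by (auto simp: c_def)
  qed
qed

text \<open>
  The real and imaginary parts of \<open>h\<close>, shifted by 1, are nonnegative weights. The transform of the conjugate
  of \<open>h\<close> at \<open>s\<close> is the conjugate of the transform of \<open>h\<close> at \<open>- s\<close>, so \<open>eqh\<close> also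
  determines the transforms of \<open>Re h\<close> and \<open>Im h\<close>.
\<close>

lemma complex_weighted_distr_eqI:
  fixes X :: "'a \<Rightarrow> real" and h :: "'a \<Rightarrow> complex"
  assumes M: "prob_space M" and N: "prob_space N" and sets_eq: "sets M = sets N"
    and X: "X \<in> borel_measurable M" and h: "h \<in> borel_measurable M"
    and h1: "\<And>x. norm (h x) \<le> 1"
    and eq1: "\<And>s. (CLINT x|M. iexp (s * X x)) = (CLINT x|N. iexp (s * X x))"
    and eqh: "\<And>s. (CLINT x|M. h x * iexp (s * X x)) = (CLINT x|N. h x * iexp (s * X x))"
    and A: "A \<in> sets borel"
  shows "(CLINT x|M. h x * indicator A (X x)) = (CLINT x|N. h x * indicator A (X x))"
proof -
  interpret M: prob_space M by fact
  interpret N: prob_space N by fact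
  have meas: "X \<in> borel_measurable K" "h \<in> borel_measurable K" if "K = M \<or> K = N" for K
    using that X h sets_eq measurable_cong_sets[OF sets_eq refl] by auto
  have AX: "indicator A (X x) = complex_of_real (indicator A (X x))" for x
    by (simp add: indicator_def)
  have one: "(LINT x|M. (1 + g (h x)) * indicator A (X x)) = (LINT x|N. (1 + g (h x)) * indicator A (X x))"
    if g: "g \<in> borel_measurable borel" "\<And>z. \<bar>g z\<bar> \<le> norm z"
      and geq: "\<And>s. (CLINT x|M. g (h x) * iexp (s * X x)) = (CLINT x|N. g (h x) * iexp (s * X x))"
    for g
  proof (rule weighted_distr_eqI[OF M N sets_eq X _ _ _ _ A, where B = 2])
    note [measurable] = g(1) meas[of M] meas[of N]
    have b: "\<bar>g (h x)\<bar> \<le> 1" for x using g(2)[of "h x"] h1[of x] by linarith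
    show "(\<lambda>x. 1 + g (h x)) \<in> borel_measurable M" by simp
    show "0 \<le> 1 + g (h x)" "1 + g (h x) \<le> 2" for x using b[of x] by linarith+
    have i: "integrable K (\<lambda>x. iexp (s * X x))" "integrable K (\<lambda>x. g (h x) * iexp (s * X x))"
      if "K = M \<or> K = N" for K s
      using that b by (auto intro!: M.integrable_const_bound[where B=1]
          N.integrable_const_bound[where B=1] simp: norm_mult)
    show "(CLINT x|M. complex_of_real (1 + g (h x)) * iexp (s * X x)) =
        (CLINT x|N. complex_of_real (1 + g (h x)) * iexp (s * X x))" for s
      using i[of M s] i[of N s] eq1[of s] geq[of s] by (simp add: ring_distribs)
  qed
  have ih: "integrable K (\<lambda>x. h x * iexp (s * X x))" if "K = M \<or> K = N" for K s
  proof -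
    note [measurable] = meas[of M] meas[of N]
    show ?thesis using that h1 by (auto intro!: M.integrable_const_bound[where B=1]
          N.integrable_const_bound[where B=1] simp: norm_mult)
  qed
  have cj: "(CLINT x|K. cnj (h x) * iexp (s * X x)) = cnj (CLINT x|K. h x * iexp (- s * X x))"
    if "K = M \<or> K = N" for K s
    by (subst Bochner_Integration.integral_cnj[symmetric]) (simp add: exp_cnj)
  have icj: "integrable K (\<lambda>x. cnj (h x) * iexp (s * X x))" if "K = M \<or> K = N" for K s
    using integrable_cnj[OF ih[OF that, of "-s"]] by (simp add: exp_cnj)
  have Re_eq: "(CLINT x|M. Re (h x) * iexp (s * X x)) = (CLINT x|N. Re (h x) * iexp (s * X x))" for s
  proof -
    have "(CLINT x|K. Re (h x) * iexp (s * X x)) =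
        ((CLINT x|K. h x * iexp (s * X x)) + (CLINT x|K. cnj (h x) * iexp (s * X x))) / 2"
      if K: "K = M \<or> K = N" for K
    proof -
      have "(CLINT x|K. Re (h x) * iexp (s * X x)) =
          (CLINT x|K. (h x * iexp (s * X x) + cnj (h x) * iexp (s * X x)) / 2)"
        by (intro Bochner_Integration.integral_cong refl)
           (simp add: distrib_right[symmetric] complex_add_cnj)
      thus ?thesis using ih[OF K] icj[OF K] by simp
    qed
    note * = this
    show ?thesis
      unfolding *[OF disjI1[OF refl]] *[OF disjI2[OF refl]] cj[OF disjI1[OF refl]] cj[OF disjI2[OF refl]] eqh ..
  qed
  have Im_eq: "(CLINT x|M. Im (h x) * iexp (s * X x)) = (CLINT x|N. Im (h x) * iexp (s * X x))" for s
  proof -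
    have "(CLINT x|K. Im (h x) * iexp (s * X x)) =
        ((CLINT x|K. h x * iexp (s * X x)) - (CLINT x|K. cnj (h x) * iexp (s * X x))) / (2 * \<i>)"
      if K: "K = M \<or> K = N" for K
    proof -
      have ii: "complex_of_real (2 * a) * \<i> * e / (2 * \<i>) = complex_of_real a * e" for a e
        by (rule nonzero_divide_eq_eq[THEN iffD2]) (simp_all add: mult_ac)
      have "(CLINT x|K. Im (h x) * iexp (s * X x)) =
          (CLINT x|K. (h x * iexp (s * X x) - cnj (h x) * iexp (s * X x)) / (2 * \<i>))"
        by (intro Bochner_Integration.integral_cong refl)
           (simp only: left_diff_distrib[symmetric] complex_diff_cnj ii)
      thus ?thesis using ih[OF K] icj[OF K] by simp
    qed
    note * = this
    show ?thesis
      unfolding *[OF disjI1[OF refl]] *[OF disjI2[OF refl]] cj[OF disjI1[OF refl]] cj[OF disjI2[OF refl]] eqh ..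
  qed
  have c1: "(LINT x|M. (1::real) * indicator A (X x)) = (LINT x|N. 1 * indicator A (X x))"
    by (rule weighted_distr_eqI[OF M N sets_eq X _ _ _ _ A, where B = 1 and h = "\<lambda>_. 1"]) (use eq1 in auto)
  note [measurable] = meas[of M] meas[of N] A
  have iA: "integrable K (\<lambda>x. indicator A (X x) :: real)"
      "integrable K (\<lambda>x. Re (h x) * indicator A (X x))" "integrable K (\<lambda>x. Im (h x) * indicator A (X x))"
      "integrable K (\<lambda>x. h x * indicator A (X x))"
    if "K = M \<or> K = N" for K
    using that h1 order_trans[OF abs_Re_le_cmod h1] order_trans[OF abs_Im_le_cmod h1]
    by (auto intro!: M.integrable_const_bound[where B=1]
          N.integrable_const_bound[where B=1] simp: norm_mult indicator_def)
  have "(LINT x|M. Re (h x) * indicator A (X x)) = (LINT x|N. Re (h x) * indicator A (X x))"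
    using one[of Re] Re_eq c1 iA[of M] iA[of N] abs_Re_le_cmod by (simp add: ring_distribs)
  moreover have "(LINT x|M. Im (h x) * indicator A (X x)) = (LINT x|N. Im (h x) * indicator A (X x))"
    using one[of Im] Im_eq c1 iA[of M] iA[of N] abs_Im_le_cmod by (simp add: ring_distribs)
  ultimately show ?thesis
    using iA(4)[of M] iA(4)[of N]
    by (intro complex_eqI) (simp_all add: integral_Re[symmetric] integral_Im[symmetric] AX)
qed

definition multivariate_char :: "'a::euclidean_space measure \<Rightarrow> 'a \<Rightarrow> complex" where
  "multivariate_char M t = (CLINT x|M. iexp (t \<bullet> x))"

text \<open>
  The coordinates are turned one by one from a frequency into an event. For a set \<open>J\<close> of coordinates
  already treated, the integrals of exponentials multiplied by the indicators of \<open>x \<bullet> b \<in> A b\<close>,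
  \<open>b \<in> J\<close>, agree. A further coordinate is added by the one-dimensional result with that product as complex weight.
  When all coordinates are treated, the measures agree on boxes.
\<close>

theorem multivariate_char_uniqueness:
  fixes M N :: "'a::euclidean_space measure"
  assumes M: "prob_space M" "sets M = sets borel" and N: "prob_space N" "sets N = sets borel"
    and eq: "\<And>t. multivariate_char M t = multivariate_char N t"
  shows "M = N"
proof -
  interpret M: prob_space M by fact
  interpret N: prob_space N by fact
  note [measurable_cong] = M(2) N(2)
  have step: "(CLINT x|M. (\<Prod>b\<in>J. indicator (A b) (x \<bullet> b)) * iexp (t \<bullet> x)) =
        (CLINT x|N. (\<Prod>b\<in>J. indicator (A b) (x \<bullet> b)) * iexp (t \<bullet> x))"
    if "finite J" "\<And>b. A b \<in> sets borel" for J t and A :: "'a \<Rightarrow> real set"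
    using that
  proof (induction J arbitrary: t)
    case empty
    show ?case using eq[of t] by (simp add: multivariate_char_def)
  next
    case (insert b J)
    note [measurable] = insert.prems
    have "(CLINT x|M. ((\<Prod>b\<in>J. indicator (A b) (x \<bullet> b)) * iexp (t \<bullet> x)) * indicator (A b) (x \<bullet> b)) =
        (CLINT x|N. ((\<Prod>b\<in>J. indicator (A b) (x \<bullet> b)) * iexp (t \<bullet> x)) * indicator (A b) (x \<bullet> b))"
    proof (rule complex_weighted_distr_eqI[OF M(1) N(1)])
      show "norm ((\<Prod>b\<in>J. indicator (A b) (x \<bullet> b)) * iexp (t \<bullet> x)) \<le> 1" for x
        by (auto simp: norm_mult prod_norm[symmetric] indicator_def intro!: prod_le_1)
      show "(CLINT x|M. iexp (s * (x \<bullet> b))) = (CLINT x|N. iexp (s * (x \<bullet> b)))" for s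
        using eq[of "s *\<^sub>R b"] by (simp add: multivariate_char_def inner_commute)
      have *: "(\<Prod>b\<in>J. indicator (A b) (x \<bullet> b)) * iexp (t \<bullet> x) * iexp (s * (x \<bullet> b))
          = (\<Prod>b\<in>J. indicator (A b) (x \<bullet> b)) * iexp ((t + s *\<^sub>R b) \<bullet> x)" for x s
        by (simp add: exp_add[symmetric] inner_add_left inner_commute[of x b] ring_distribs mult.assoc)
      show "(CLINT x|M. (\<Prod>b\<in>J. indicator (A b) (x \<bullet> b)) * iexp (t \<bullet> x) * iexp (s * (x \<bullet> b))) =
          (CLINT x|N. (\<Prod>b\<in>J. indicator (A b) (x \<bullet> b)) * iexp (t \<bullet> x) * iexp (s * (x \<bullet> b)))" for s
        unfolding * by (rule insert.IH) fact
    qed (use M N in auto)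
    thus ?case using insert.hyps by (simp add: mult_ac)
  qed
  show ?thesis
  proof (rule measure_eqI_generator_eq[where \<Omega> = UNIV and E = "range (\<lambda>(a::'a, b). box a b)"
          and A = "\<lambda>n. box (- (real n *\<^sub>R One)) (real n *\<^sub>R One)"])
    show "Int_stable (range (\<lambda>(a::'a, b). box a b))"
      by (auto simp: Int_stable_def box_Int_box)
    show "emeasure M X = emeasure N X" if "X \<in> range (\<lambda>(a::'a, b). box a b)" for X
    proof -
      obtain a b where X: "X = box a b" using \<open>X \<in> _\<close> by auto
      have ind: "(\<Prod>i\<in>Basis. indicator {a \<bullet> i<..<b \<bullet> i} (x \<bullet> i)) * iexp (0 \<bullet> x) =
          complex_of_real (indicator X x)" for x
        by (auto simp: X indicator_def mem_box)
      have [measurable]: "X \<in> sets borel" by (simp add: X)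
      have "complex_of_real (measure M X) = complex_of_real (measure N X)"
        using step[of Basis "\<lambda>i. {a \<bullet> i<..<b \<bullet> i}" 0] unfolding ind
        using M(2) N(2) by (simp add: \<open>X \<in> sets borel\<close>)
      thus ?thesis by (simp add: M.emeasure_eq_measure N.emeasure_eq_measure)
    qed
    show "sets M = sigma_sets UNIV (range (\<lambda>(a, b). box a b))"
        "sets N = sigma_sets UNIV (range (\<lambda>(a, b). box a b))"
      unfolding M(2) N(2) by (simp_all add: borel_eq_box)
    show "(\<Union>n. box (- (real n *\<^sub>R One)) (real n *\<^sub>R One)) = (UNIV::'a set)"
      by (rule UN_box_eq_UNIV)
  qed auto
qed

section \<open>Gaussian laws on Euclidean spaces\<close>

lemma multivariate_char_distr_linear:
  assumes "linear T" "sets M = sets borel"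
  shows "multivariate_char (distr M borel (\<lambda>x. a + T x)) t = iexp (t \<bullet> a) * multivariate_char M (adjoint T t)"
proof -
  have T: "T \<in> borel_measurable borel"
    using assms(1) by (intro borel_measurable_continuous_onI linear_continuous_on linear_conv_bounded_linear[THEN iffD1])
  note [measurable] = T and [measurable_cong] = assms(2)
  have "multivariate_char (distr M borel (\<lambda>x. a + T x)) t = (CLINT x|M. iexp (t \<bullet> (a + T x)))"
    unfolding multivariate_char_def by (subst integral_distr) auto
  also have "\<dots> = (CLINT x|M. iexp (t \<bullet> a) * iexp (adjoint T t \<bullet> x))"
    by (intro Bochner_Integration.integral_cong refl)
       (simp add: adjoint_clauses[OF assms(1)] inner_add_right exp_add ring_distribs)
  finally show ?thesis by (simp add: multivariate_char_def)
qed

lemma multivariate_char_pair: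
  fixes M :: "'a::euclidean_space measure" and N :: "'b::euclidean_space measure"
  assumes M: "prob_space M" "sets M = sets borel" and N: "prob_space N" "sets N = sets borel"
  shows "multivariate_char (M \<Otimes>\<^sub>M N) (s, t) = multivariate_char M s * multivariate_char N t"
proof -
  interpret M: prob_space M by fact
  interpret N: prob_space N by fact
  interpret pair_prob_space M N ..
  note [measurable_cong] = M(2) N(2)
  have "integrable (M \<Otimes>\<^sub>M N) (\<lambda>(x, y). iexp (s \<bullet> x) * iexp (t \<bullet> y))"
    by (rule integrable_const_bound[where B = 1]) (auto simp: norm_mult)
  from integral_fst[OF this]
  have "(CLINT x|M. CLINT y|N. iexp (s \<bullet> x) * iexp (t \<bullet> y))
      = (CLINT z|M \<Otimes>\<^sub>M N. (case z of (x, y) \<Rightarrow> iexp (s \<bullet> x) * iexp (t \<bullet> y)))" .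
  also have "\<dots> = multivariate_char (M \<Otimes>\<^sub>M N) (s, t)"
    unfolding multivariate_char_def
    by (intro Bochner_Integration.integral_cong refl) (auto simp: exp_add ring_distribs)
  finally show ?thesis by (simp add: multivariate_char_def)
qed

lemma char_univariate_normal:
  assumes "univariate_normal m v M"
  shows "char M t = exp (\<i> * (t * m) - t\<^sup>2 * v / 2)"
proof (cases "v = 0")
  case True
  hence "M = return borel m" using assms by (simp add: univariate_normal_def)
  thus ?thesis using True by (simp add: char_def integral_return)
next
  case False
  hence v: "v > 0" and M: "M = density lborel (normal_density m (sqrt v))"
    using assms by (auto simp: univariate_normal_def)
  have "M = distr std_normal_distribution borel (\<lambda>x. m + sqrt v * x)"
  proof -
    interpret S: prob_space std_normal_distribution by (simp add: prob_space_normal_density)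
    have "distributed std_normal_distribution lborel (\<lambda>x. x) std_normal_density"
      by (auto simp: distributed_def distr_id2)
    hence "distributed std_normal_distribution lborel (\<lambda>x. ((m + sqrt v * x) - m) / sqrt v) std_normal_density"
      using v by simp
    hence "distributed std_normal_distribution lborel (\<lambda>x. m + sqrt v * x) (normal_density m (sqrt v))"
      using v by (subst S.normal_standard_normal_convert) auto
    hence "distr std_normal_distribution lborel (\<lambda>x. m + sqrt v * x) = M"
      by (simp add: distributed_def M)
    thus ?thesis by (metis distr_cong sets_lborel)
  qed
  hence "char M t = (CLINT x|std_normal_distribution. iexp (t * (m + sqrt v * x)))"
    unfolding char_def by (simp add: integral_distr)
  also have "\<dots> = (CLINT x|std_normal_distribution. iexp (t * m) * iexp ((t * sqrt v) * x))"
    by (intro Bochner_Integration.integral_cong refl) (simp add: exp_add[symmetric] ring_distribs mult_ac)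
  also have "\<dots> = iexp (t * m) * char std_normal_distribution (t * sqrt v)"
    by (simp add: char_def)
  also have "\<dots> = exp (\<i> * (t * m) - t\<^sup>2 * v / 2)"
  proof -
    have "char std_normal_distribution (t * sqrt v) = exp (- (t\<^sup>2 * v / 2))"
      using v by (simp add: char_std_normal_distribution power_mult_distrib)
    moreover have "exp (\<i> * (t * m) - t\<^sup>2 * v / 2) = iexp (t * m) * exp (complex_of_real (- (t\<^sup>2 * v / 2)))"
      by (subst exp_add[symmetric]) simp
    ultimately show ?thesis by (simp only: exp_of_real)
  qed
  finally show ?thesis .
qed

lemma multivariate_char_multivariate_normal:
  assumes "multivariate_normal m C M"
  shows "multivariate_char M t = exp (\<i> * (t \<bullet> m) - (t \<bullet> C t) / 2)"
proof -
  have s: "sets M = sets borel" and u: "univariate_normal (t \<bullet> m) (t \<bullet> C t) (distr M borel (\<lambda>x. t \<bullet> x))"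
    using assms by (auto simp: multivariate_normal_def)
  note [measurable_cong] = s
  have "multivariate_char M t = char (distr M borel (\<lambda>x. t \<bullet> x)) 1"
    unfolding multivariate_char_def char_def by (subst integral_distr) auto
  thus ?thesis using char_univariate_normal[OF u, of 1] by simp
qed

text \<open>
  The covariance operator of the image is \<open>T \<circ> C \<circ> adjoint T\<close>. Since it is determined by its quadratic
  form, it suffices to compare \<open>D\<close> with it on the diagonal.
\<close>

lemma multivariate_normal_linear_image:
  assumes M: "multivariate_normal 0 C M" and T: "linear T"
    and D: "linear D" "\<And>u v. u \<bullet> D v = D u \<bullet> v"
    and DC: "\<And>u. u \<bullet> D u = adjoint T u \<bullet> C (adjoint T u)"
  shows "multivariate_normal 0 D (distr M borel T)"
proof -
  have [measurable]: "T \<in> borel_measurable borel"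
    using T by (intro borel_measurable_continuous_onI linear_continuous_on linear_conv_bounded_linear[THEN iffD1])
  have s: "prob_space M" "sets M = sets borel"
     and u: "\<And>t. univariate_normal 0 (t \<bullet> C t) (distr M borel (\<lambda>x. t \<bullet> x))"
    using M by (auto simp: multivariate_normal_def)
  note [measurable_cong] = s(2)
  show ?thesis unfolding multivariate_normal_def
  proof (intro conjI allI)
    show "prob_space (distr M borel T)" using s(1) by (intro prob_space.prob_space_distr) auto
    fix t
    have "(\<lambda>x. t \<bullet> T x) = (\<lambda>x. adjoint T t \<bullet> x)"
      by (rule ext) (simp add: adjoint_clauses[OF T])
    hence "distr (distr M borel T) borel (\<lambda>x. t \<bullet> x) = distr M borel (\<lambda>x. adjoint T t \<bullet> x)"
      by (subst distr_distr) (auto simp: comp_def)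
    thus "univariate_normal (t \<bullet> 0) (t \<bullet> D t) (distr (distr M borel T) borel ((\<bullet>) t))"
      using u[of "adjoint T t"] by (simp add: DC)
  qed (use D in auto)
qed


definition std_multivariate_normal_density :: "'a::euclidean_space \<Rightarrow> real" where
  "std_multivariate_normal_density x = exp (- (norm x)\<^sup>2 / 2) / sqrt (2 * pi) ^ DIM('a)"

definition std_multivariate_normal :: "'a::euclidean_space measure" where
  "std_multivariate_normal = density lborel (\<lambda>x. ennreal (std_multivariate_normal_density x))"

lemma std_multivariate_normal_density_prod:
  "std_multivariate_normal_density (x::'a::euclidean_space) = (\<Prod>b\<in>Basis. std_normal_density (x \<bullet> b))"
proof -
  have "(norm x)\<^sup>2 = (\<Sum>b\<in>Basis. (x \<bullet> b)\<^sup>2)"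
    unfolding power2_norm_eq_inner by (subst euclidean_inner) (simp add: power2_eq_square)
  hence "exp (- (norm x)\<^sup>2 / 2) = (\<Prod>b\<in>Basis. exp (- (x \<bullet> b)\<^sup>2 / 2))"
    by (simp add: exp_sum[symmetric] sum_negf sum_divide_distrib)
  thus ?thesis by (simp add: std_multivariate_normal_density_def std_normal_density_def prod_dividef)
qed

lemma std_multivariate_normal_density_measurable [measurable]:
  "std_multivariate_normal_density \<in> borel_measurable borel"
  unfolding std_multivariate_normal_density_def[abs_def] by measurable

lemma prob_space_std_multivariate_normal: "prob_space (std_multivariate_normal :: 'a::euclidean_space measure)"
proof
  have "emeasure (std_multivariate_normal :: 'a measure) (space std_multivariate_normal) =
      (\<integral>\<^sup>+x. (\<Prod>b\<in>(Basis::'a set). ennreal (std_normal_density (x \<bullet> b))) \<partial>lborel)"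
    by (simp add: std_multivariate_normal_def emeasure_density std_multivariate_normal_density_prod prod_ennreal)
  also have "\<dots> = (\<Prod>b\<in>(Basis::'a set). \<integral>\<^sup>+x. ennreal (std_normal_density x) \<partial>lborel)"
    by (rule nn_integral_lborel_prod) auto
  also have "(\<integral>\<^sup>+x. ennreal (std_normal_density x) \<partial>lborel) = 1"
    using prob_space.emeasure_space_1[OF prob_space_normal_density[of 1 0]]
    by (simp add: emeasure_density)
  finally show "emeasure (std_multivariate_normal :: 'a measure) (space std_multivariate_normal) = 1" by simp
qed

text \<open>
  Lebesgue measure is a product over the basis and both the density and the exponential factorize, which
  reduces the claim to the one-dimensional standard normal law.
\<close>

lemma multivariate_char_std_multivariate_normal: "multivariate_char std_multivariate_normal t = exp (- (t \<bullet> t) / 2)"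
proof -
  have int: "complex_integrable lborel (\<lambda>x. std_normal_density x *\<^sub>R iexp (s * x))" for s
  proof -
    have "complex_integrable std_normal_distribution (\<lambda>x. iexp (s * x))"
      by (intro finite_measure.integrable_const_bound[where B=1] prob_space.finite_measure
          prob_space_normal_density) auto
    thus ?thesis by (subst (asm) integrable_density) auto
  qed
  have one: "(CLINT x|lborel. std_normal_density x *\<^sub>R iexp (s * x)) = exp (- s\<^sup>2 / 2)" for s
    using fun_cong[OF char_std_normal_distribution, of s]
    unfolding char_def by (subst (asm) integral_density) auto
  interpret product_sigma_finite "\<lambda>_::'a. lborel :: real measure" ..
  have "multivariate_char std_multivariate_normal t = (CLINT x|lborel. std_multivariate_normal_density x *\<^sub>R iexp (t \<bullet> x))"
    unfolding multivariate_char_def std_multivariate_normal_def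
    by (subst integral_density) (auto simp: std_multivariate_normal_density_def)
  also have "\<dots> = (CLINT f|\<Pi>\<^sub>M b\<in>(Basis::'a set). lborel.
      std_multivariate_normal_density (\<Sum>b\<in>(Basis::'a set). f b *\<^sub>R b) *\<^sub>R iexp (t \<bullet> (\<Sum>b\<in>(Basis::'a set). f b *\<^sub>R b)))"
    by (subst lborel_eq, subst integral_distr) auto
  also have "\<dots> = (CLINT f|\<Pi>\<^sub>M b\<in>(Basis::'a set). lborel.
      (\<Prod>b\<in>(Basis::'a set). std_normal_density (f b) *\<^sub>R iexp ((t \<bullet> b) * f b)))"
  proof (intro Bochner_Integration.integral_cong refl)
    fix f :: "'a \<Rightarrow> real"
    have "iexp (t \<bullet> (\<Sum>b\<in>(Basis::'a set). f b *\<^sub>R b)) = (\<Prod>b\<in>(Basis::'a set). iexp ((t \<bullet> b) * f b))"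
      by (simp add: exp_sum[symmetric] inner_sum_right sum_distrib_left mult_ac)
    moreover have "std_multivariate_normal_density (\<Sum>b\<in>(Basis::'a set). f b *\<^sub>R b)
        = (\<Prod>b\<in>(Basis::'a set). std_normal_density (f b))"
      unfolding std_multivariate_normal_density_prod by (intro prod.cong refl) simp
    ultimately show "std_multivariate_normal_density (\<Sum>b\<in>(Basis::'a set). f b *\<^sub>R b) *\<^sub>R iexp (t \<bullet> (\<Sum>b\<in>(Basis::'a set). f b *\<^sub>R b)) =
      (\<Prod>b\<in>(Basis::'a set). std_normal_density (f b) *\<^sub>R iexp ((t \<bullet> b) * f b))"
      by (simp add: scaleR_conv_of_real prod.distrib)
  qed
  also have "\<dots> = (\<Prod>b\<in>(Basis::'a set). CLINT x|lborel. std_normal_density x *\<^sub>R iexp ((t \<bullet> b) * x))"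
    by (rule product_integral_prod) (use int in auto)
  also have "\<dots> = (\<Prod>b\<in>(Basis::'a set). exp (- complex_of_real ((t \<bullet> b)\<^sup>2) / 2))"
    by (intro prod.cong refl) (simp only: one, simp flip: exp_of_real)
  also have "\<dots> = exp (\<Sum>b\<in>(Basis::'a set). - complex_of_real ((t \<bullet> b)\<^sup>2) / 2)"
    by (simp add: exp_sum)
  also have "(\<Sum>b\<in>(Basis::'a set). - complex_of_real ((t \<bullet> b)\<^sup>2) / 2) = - (t \<bullet> t) / 2"
    by (subst euclidean_inner[of t t]) (simp add: sum_negf sum_divide_distrib power2_eq_square)
  finally show ?thesis by (simp only: exp_of_real)
qed

section \<open>Logarithmic scale integrals and the chi-squared law\<close>

text \<open>
  In the coordinate \<open>ln s\<close> the scale-invariant measure \<open>ds / s\<close> on the positive half-line is Lebesgue measure.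
  The substitution rule covers compact intervals, and monotone convergence gives the whole line.
\<close>

lemma distr_exp_lborel:
  "distr lborel borel exp = density lborel (\<lambda>s::real. indicator {0<..} s * ennreal (1 / s))"
proof (rule measure_eqI)
  fix A assume "A \<in> sets (distr lborel borel (exp :: real \<Rightarrow> real))"
  hence [measurable]: "A \<in> sets (borel :: real measure)" by simp
  have sup: "(SUP n. F t * indicator (I n) t) = F t"
    if "\<And>t. t \<in> (\<Union>n. I n) \<or> F t = 0" for F :: "real \<Rightarrow> ennreal" and I :: "nat \<Rightarrow> real set" and t
  proof (rule antisym)
    show "(SUP n. F t * indicator (I n) t) \<le> F t"
      by (rule SUP_least) (auto simp: indicator_def)
    show "F t \<le> (SUP n. F t * indicator (I n) t)"
      using that[of t]
    proof
      assume "t \<in> (\<Union>n. I n)"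
      then obtain n where "t \<in> I n" by blast
      thus ?thesis by (intro SUP_upper2[of n]) auto
    qed simp
  qed
  have mono: "incseq (\<lambda>n t. F t * indicator (I n) t)"
    if "\<And>m n. m \<le> n \<Longrightarrow> I m \<subseteq> I n" for F :: "real \<Rightarrow> ennreal" and I :: "nat \<Rightarrow> real set"
    using that by (force simp: incseq_def le_fun_def indicator_def)
  define I where "I n = {- real n..real n}" for n
  define J where "J n = {exp (- real n)..exp (real n)}" for n
  have I: "t \<in> (\<Union>n. I n)" for t
  proof -
    obtain n where "\<bar>t\<bar> \<le> real n" using real_arch_simple by blast
    thus ?thesis by (auto simp: I_def abs_le_iff intro!: exI[of _ n])
  qed
  have J: "s \<in> (\<Union>n. J n)" if "0 < s" for s
  proof -
    obtain n where "ln s \<in> I n" using I by blast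
    hence "exp (ln s) \<in> J n" unfolding I_def J_def by simp
    thus ?thesis using that by auto
  qed
  have J0: "J n \<subseteq> {0<..}" for n by (auto simp: J_def intro: less_le_trans[OF exp_gt_zero])
  have "emeasure (distr lborel borel exp) A = (\<integral>\<^sup>+t. indicator A (exp t) \<partial>lborel)"
  proof -
    have "emeasure (distr lborel borel exp) A = (\<integral>\<^sup>+y. indicator A y \<partial>distr lborel borel (exp :: real \<Rightarrow> real))"
      by simp
    also have "\<dots> = (\<integral>\<^sup>+t. indicator A (exp t) \<partial>lborel)"
      by (rule nn_integral_distr) auto
    finally show ?thesis .
  qed
  also have "\<dots> = (\<integral>\<^sup>+t. (SUP n. indicator A (exp t) * indicator (I n) t) \<partial>lborel)"
    using sup[of I "\<lambda>t. indicator A (exp t)"] I by simp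
  also have "\<dots> = (SUP n. \<integral>\<^sup>+t. indicator A (exp t) * indicator (I n) t \<partial>lborel)"
    by (intro nn_integral_monotone_convergence_SUP mono) (auto simp: I_def)
  also have "\<dots> = (SUP n. \<integral>\<^sup>+s. (indicator {0<..} s * ennreal (1 / s) * indicator A s) * indicator (J n) s \<partial>lborel)"
  proof (intro SUP_cong refl)
    fix n
    have "(\<integral>\<^sup>+s. (indicator {0<..} s * ennreal (1 / s) * indicator A s) * indicator (J n) s \<partial>lborel)
        = (\<integral>\<^sup>+s. ennreal (indicator A s / s * indicator (J n) s) \<partial>lborel)"
      using J0[of n] by (intro nn_integral_cong) (auto simp: indicator_def)
    also have "\<dots> = (\<integral>\<^sup>+t. ennreal (indicator A (exp t) / exp t * exp t * indicator (I n) t) \<partial>lborel)"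
      unfolding I_def J_def
      by (rule nn_integral_substitution[where f = "\<lambda>s. indicator A s / s" and g = exp and g' = exp and a = "- real n" and b = "real n"])
         (auto intro!: derivative_eq_intros continuous_intros simp: set_borel_measurable_def)
    also have "\<dots> = (\<integral>\<^sup>+t. indicator A (exp t) * indicator (I n) t \<partial>lborel)"
      by (intro nn_integral_cong) (auto simp: indicator_def simp flip: ennreal_mult')
    finally show "(\<integral>\<^sup>+t. indicator A (exp t) * indicator (I n) t \<partial>lborel) =
      (\<integral>\<^sup>+s. (indicator {0<..} s * ennreal (1 / s) * indicator A s) * indicator (J n) s \<partial>lborel)" ..
  qed
  also have "\<dots> = (\<integral>\<^sup>+s. (SUP n. (indicator {0<..} s * ennreal (1 / s) * indicator A s) * indicator (J n) s) \<partial>lborel)"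
    by (intro nn_integral_monotone_convergence_SUP[symmetric] mono) (auto simp: J_def)
  also have "\<dots> = (\<integral>\<^sup>+s. indicator {0<..} s * ennreal (1 / s) * indicator A s \<partial>lborel)"
    using J by (intro nn_integral_cong sup) (auto simp: indicator_def)
  finally show "emeasure (distr lborel borel exp) A =
      emeasure (density lborel (\<lambda>s. indicator {0<..} s * ennreal (1 / s))) A"
    by (simp add: emeasure_density)
qed simp

text \<open>
  On the logarithmic scale \<open>s \<mapsto> r / s\<close> is the reflection \<open>t \<mapsto> ln r - t\<close>, which preserves Lebesgue measure.
\<close>

lemma nn_integral_inverse_reflect:
  fixes f :: "real \<Rightarrow> ennreal"
  assumes [measurable]: "f \<in> borel_measurable borel" and r: "r > 0"
  shows "(\<integral>\<^sup>+s. indicator {0<..} s * ennreal (1 / s) * f s \<partial>lborel) =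
      (\<integral>\<^sup>+v. indicator {0<..} v * ennreal (1 / v) * f (r / v) \<partial>lborel)"
proof -
  have log: "(\<integral>\<^sup>+s. indicator {0<..} s * ennreal (1 / s) * g s \<partial>lborel) = (\<integral>\<^sup>+t. g (exp t) \<partial>lborel)"
    if [measurable]: "g \<in> borel_measurable borel" for g :: "real \<Rightarrow> ennreal"
  proof -
    have "(\<integral>\<^sup>+t. g (exp t) \<partial>lborel) = (\<integral>\<^sup>+s. g s \<partial>distr lborel borel (exp :: real \<Rightarrow> real))"
      by (subst nn_integral_distr) auto
    also have "\<dots> = (\<integral>\<^sup>+s. indicator {0<..} s * ennreal (1 / s) * g s \<partial>lborel)"
      unfolding distr_exp_lborel by (subst nn_integral_density) auto
    finally show ?thesis ..
  qed
  have "(\<integral>\<^sup>+t. f (exp t) \<partial>lborel) = (\<integral>\<^sup>+t. f (exp (ln r + (-1) * t)) \<partial>lborel)"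
    by (subst nn_integral_real_affine[where c = "-1" and t = "ln r"]) auto
  also have "\<dots> = (\<integral>\<^sup>+t. f (r / exp t) \<partial>lborel)"
    using r by (simp add: exp_diff)
  finally show ?thesis by (subst (1 2) log) auto
qed

lemma prob_space_chi_squared:
  assumes k: "k > 0"
  shows "prob_space (chi_squared k)"
proof
  define a where "a = real k / 2"
  have a: "a > 0" using k by (simp add: a_def)
  have G: "Gamma a > 0" using a by (rule Gamma_real_pos)
  have "emeasure (chi_squared k) (space (chi_squared k)) =
      (\<integral>\<^sup>+v. ennreal (if v \<le> 0 then 0 else v powr (a - 1) * exp (- v / 2) / (2 powr a * Gamma a)) \<partial>lborel)"
    unfolding a_def by (simp add: chi_squared_def emeasure_density)
  also have "\<dots> = ennreal 2 * (\<integral>\<^sup>+t. ennreal (if 0 + 2 * t \<le> 0 then 0 else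
      (0 + 2 * t) powr (a - 1) * exp (- (0 + 2 * t) / 2) / (2 powr a * Gamma a)) \<partial>lborel)"
    by (subst nn_integral_real_affine[where c = 2 and t = 0]) auto
  also have "\<dots> = (\<integral>\<^sup>+t. ennreal 2 * ennreal (if 0 + 2 * t \<le> 0 then 0 else
      (0 + 2 * t) powr (a - 1) * exp (- (0 + 2 * t) / 2) / (2 powr a * Gamma a)) \<partial>lborel)"
    by (rule nn_integral_cmult[symmetric]) auto
  also have "\<dots> = (\<integral>\<^sup>+t. ennreal (1 / Gamma a) * ennreal (indicator {0..} t * t powr (a - 1) / exp t) \<partial>lborel)"
  proof (rule nn_integral_cong_AE, rule AE_I2)
    fix t :: real
    have "ennreal 2 * ennreal (if 0 + 2 * t \<le> 0 then 0 else (0 + 2 * t) powr (a - 1) * exp (- (0 + 2 * t) / 2) / (2 powr a * Gamma a)) = ennreal (2 * (if 0 + 2 * t \<le> 0 then 0 else (0 + 2 * t) powr (a - 1) * exp (- (0 + 2 * t) / 2) / (2 powr a * Gamma a)))"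
      using G by (intro ennreal_mult[symmetric]) auto
    also have "2 * (if 0 + 2 * t \<le> 0 then 0 else (0 + 2 * t) powr (a - 1) * exp (- (0 + 2 * t) / 2) / (2 powr a * Gamma a)) = 1 / Gamma a * (indicator {0..} t * t powr (a - 1) / exp t)"
    proof (cases "t > 0")
      case True
      have "2 * ((2 * t) powr (a - 1) * exp (- t) / (2 powr a * Gamma a)) = 1 / Gamma a * (t powr (a - 1) / exp t)"
        using True G by (simp add: powr_mult powr_diff exp_minus field_simps)
      thus ?thesis using True by simp
    qed (auto simp: indicator_def)
    also have "ennreal (1 / Gamma a * (indicator {0..} t * t powr (a - 1) / exp t)) = ennreal (1 / Gamma a) * ennreal (indicator {0..} t * t powr (a - 1) / exp t)"
      using G by (intro ennreal_mult) auto
    finally show "ennreal 2 * ennreal (if 0 + 2 * t \<le> 0 then 0 else (0 + 2 * t) powr (a - 1) * exp (- (0 + 2 * t) / 2) / (2 powr a * Gamma a)) =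
      ennreal (1 / Gamma a) * ennreal (indicator {0..} t * t powr (a - 1) / exp t)" .
  qed
  also have "\<dots> = ennreal (1 / Gamma a) * ennreal (Gamma a)"
    by (subst nn_integral_cmult) (auto simp: Gamma_conv_nn_integral_real[OF a])
  also have "\<dots> = 1" using G by (simp flip: ennreal_mult'')
  finally show "emeasure (chi_squared k) (space (chi_squared k)) = 1" .
qed

lemma sets_chi_squared [measurable_cong, simp]: "sets (chi_squared k) = sets borel"
  by (simp add: chi_squared_def)

text \<open>
  The ratio of the normalizing constants of the standard normal density in dimension \<open>k\<close> and of the
  chi-squared density. The densities of \<open>sqrt s \<xi>\<close>, for standard normal \<open>\<xi>\<close>, integrate over
  \<open>ds / s\<close> to \<open>radial_const k * |x|\<^sup>-\<^sup>k\<close>.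
\<close>

definition radial_const :: "nat \<Rightarrow> real" where
  "radial_const k = 2 powr (real k / 2) * Gamma (real k / 2) / sqrt (2 * pi) ^ k"

text \<open>
  The Bayesian core. For fixed \<open>s\<close> the law of \<open>x = sqrt s \<xi>\<close> has a Gaussian density in \<open>x\<close>. After
  exchanging the integrals, the substitution \<open>s = |x|\<^sup>2 / v\<close>, which preserves \<open>ds / s\<close>, turns this density
  into \<open>|x|\<^sup>-\<^sup>k\<close> times the chi-squared density in \<open>v\<close>.
\<close>

lemma nn_integral_scale_mixture:
  fixes h :: "real \<times> 'a::euclidean_space \<Rightarrow> ennreal"
  assumes [measurable]: "h \<in> borel_measurable borel"
  defines "k \<equiv> DIM('a)"
  shows "(\<integral>\<^sup>+s. indicator {0<..} s * ennreal (1 / s) * (\<integral>\<^sup>+\<xi>. h (s, sqrt s *\<^sub>R \<xi>) \<partial>std_multivariate_normal) \<partial>lborel) =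
    (\<integral>\<^sup>+x. ennreal (radial_const k * norm x powr (- real k)) *
        (\<integral>\<^sup>+v. h ((norm x)\<^sup>2 / v, x) \<partial>chi_squared k) \<partial>lborel)"
proof -
  have k: "k > 0" by (simp add: k_def)
  define \<psi> where "\<psi> s x = std_multivariate_normal_density (x /\<^sub>R sqrt s) * (1 / sqrt s) ^ k" for s and x :: 'a
  have [measurable]: "(\<lambda>(s, x). \<psi> s x) \<in> borel_measurable (lborel \<Otimes>\<^sub>M lborel)"
    unfolding \<psi>_def by measurable
  have \<psi>0: "0 \<le> \<psi> s x" if "s > 0" for s x using that by (simp add: \<psi>_def std_multivariate_normal_density_def)
  have rescale: "(\<integral>\<^sup>+\<xi>. h (s, sqrt s *\<^sub>R \<xi>) \<partial>std_multivariate_normal) = (\<integral>\<^sup>+x. ennreal (\<psi> s x) * h (s, x) \<partial>lborel)"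
    if s: "s > 0" for s
  proof -
    have "(\<integral>\<^sup>+\<xi>. h (s, sqrt s *\<^sub>R \<xi>) \<partial>std_multivariate_normal) =
        (\<integral>\<^sup>+\<xi>. ennreal (std_multivariate_normal_density \<xi>) * h (s, sqrt s *\<^sub>R \<xi>) \<partial>lborel)"
      unfolding std_multivariate_normal_def by (subst nn_integral_density) auto
    also have "\<dots> = (\<integral>\<^sup>+x. ennreal ((1 / sqrt s) ^ k) *
        (ennreal (std_multivariate_normal_density (x /\<^sub>R sqrt s)) * h (s, sqrt s *\<^sub>R (x /\<^sub>R sqrt s))) \<partial>lborel)"
      using s by (subst lborel_affine[of "1 / sqrt s" 0])
        (auto simp: nn_integral_density nn_integral_distr k_def divide_inverse)
    also have "\<dots> = (\<integral>\<^sup>+x. ennreal (\<psi> s x) * h (s, x) \<partial>lborel)"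
    proof (intro nn_integral_cong)
      fix x :: 'a
      have "0 \<le> std_multivariate_normal_density (x /\<^sub>R sqrt s)" "0 \<le> (1 / sqrt s) ^ k"
        using s by (auto simp: std_multivariate_normal_density_def)
      from ennreal_mult[OF this] show "ennreal ((1 / sqrt s) ^ k) *
        (ennreal (std_multivariate_normal_density (x /\<^sub>R sqrt s)) * h (s, sqrt s *\<^sub>R (x /\<^sub>R sqrt s))) = ennreal (\<psi> s x) * h (s, x)"
        using s by (simp add: \<psi>_def mult_ac)
    qed
    finally show ?thesis .
  qed
  have meas: "(\<lambda>(s, x). indicator {0<..} s * ennreal (1 / s) * (ennreal (\<psi> s x) * h (s, x)))
      \<in> borel_measurable (lborel \<Otimes>\<^sub>M lborel)"
    by measurable
  have "(\<integral>\<^sup>+s. indicator {0<..} s * ennreal (1 / s) * (\<integral>\<^sup>+\<xi>. h (s, sqrt s *\<^sub>R \<xi>) \<partial>std_multivariate_normal) \<partial>lborel)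
      = (\<integral>\<^sup>+s. \<integral>\<^sup>+x. indicator {0<..} s * ennreal (1 / s) * (ennreal (\<psi> s x) * h (s, x)) \<partial>lborel \<partial>lborel)"
  proof (intro nn_integral_cong)
    fix s :: real
    show "indicator {0<..} s * ennreal (1 / s) * (\<integral>\<^sup>+\<xi>. h (s, sqrt s *\<^sub>R \<xi>) \<partial>std_multivariate_normal) =
      (\<integral>\<^sup>+x. indicator {0<..} s * ennreal (1 / s) * (ennreal (\<psi> s x) * h (s, x)) \<partial>lborel)"
    proof (cases "s > 0")
      case True
      have "(\<integral>\<^sup>+x. indicator {0<..} s * ennreal (1 / s) * (ennreal (\<psi> s x) * h (s, x)) \<partial>lborel) =
        indicator {0<..} s * ennreal (1 / s) * (\<integral>\<^sup>+x. (ennreal (\<psi> s x) * h (s, x)) \<partial>lborel)"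
        by (rule nn_integral_cmult) simp
      thus ?thesis using rescale[OF True] by simp
    qed simp
  qed
  also have "\<dots> = (\<integral>\<^sup>+x. \<integral>\<^sup>+s. indicator {0<..} s * ennreal (1 / s) * (ennreal (\<psi> s x) * h (s, x)) \<partial>lborel \<partial>lborel)"
    by (rule lborel_pair.Fubini'[symmetric, OF meas])
  also have "\<dots> = (\<integral>\<^sup>+x. ennreal (radial_const k * norm x powr (- real k)) *
        (\<integral>\<^sup>+v. h ((norm x)\<^sup>2 / v, x) \<partial>chi_squared k) \<partial>lborel)"
  proof (rule nn_integral_cong_AE)
    have "AE x in lborel. x \<noteq> (0::'a)" by (rule AE_lborel_singleton)
    thus "AE x in lborel. (\<integral>\<^sup>+s. indicator {0<..} s * ennreal (1 / s) * (ennreal (\<psi> s x) * h (s, x)) \<partial>lborel) =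
        ennreal (radial_const k * norm x powr (- real k)) * (\<integral>\<^sup>+v. h ((norm x)\<^sup>2 / v, x) \<partial>chi_squared k)"
    proof eventually_elim
      case (elim x)
      hence r: "(norm x)\<^sup>2 > 0" by simp
      have "(\<integral>\<^sup>+s. indicator {0<..} s * ennreal (1 / s) * (ennreal (\<psi> s x) * h (s, x)) \<partial>lborel) =
          (\<integral>\<^sup>+v. indicator {0<..} v * ennreal (1 / v) * (ennreal (\<psi> ((norm x)\<^sup>2 / v) x) * h ((norm x)\<^sup>2 / v, x)) \<partial>lborel)"
        by (rule nn_integral_inverse_reflect[OF _ r, of "\<lambda>s. ennreal (\<psi> s x) * h (s, x)"]) measurable
      also have "\<dots> = (\<integral>\<^sup>+v. ennreal (radial_const k * norm x powr (- real k)) * (ennreal (if v \<le> 0 then 0 else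
     v powr (real k / 2 - 1) * exp (- v / 2) / (2 powr (real k / 2) * Gamma (real k / 2))) * h ((norm x)\<^sup>2 / v, x)) \<partial>lborel)"
      proof (intro nn_integral_cong)
        fix v :: real
        show "indicator {0<..} v * ennreal (1 / v) * (ennreal (\<psi> ((norm x)\<^sup>2 / v) x) * h ((norm x)\<^sup>2 / v, x)) =
          ennreal (radial_const k * norm x powr (- real k)) * (ennreal (if v \<le> 0 then 0 else
     v powr (real k / 2 - 1) * exp (- v / 2) / (2 powr (real k / 2) * Gamma (real k / 2))) * h ((norm x)\<^sup>2 / v, x))"
        proof (cases "v > 0")
          case v: True
          have G: "Gamma (real k / 2) > 0" using k by (intro Gamma_real_pos) simp
          have sq: "sqrt ((norm x)\<^sup>2 / v) = norm x / sqrt v"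
            using elim by (simp add: real_sqrt_divide)
          have nx: "norm (x /\<^sub>R (norm x / sqrt v)) = sqrt v"
            using elim v by simp
          have pw: "sqrt v ^ k = v powr (real k / 2)"
            using v by (simp add: powr_half_sqrt[symmetric] powr_powr flip: powr_realpow)
          have psi: "\<psi> ((norm x)\<^sup>2 / v) x = exp (- v / 2) / sqrt (2 * pi) ^ k * (v powr (real k / 2) * norm x powr (- real k))"
          proof -
            have "norm x powr (- real k) = 1 / norm x ^ k"
              using elim by (simp add: powr_minus_divide powr_realpow)
            thus ?thesis
              unfolding \<psi>_def sq std_multivariate_normal_density_def nx pw[symmetric] k_def[symmetric]
              using v by (simp add: power_divide)
          qed
          have "1 / v * \<psi> ((norm x)\<^sup>2 / v) x = radial_const k * norm x powr (- real k) *
            (v powr (real k / 2 - 1) * exp (- v / 2) / (2 powr (real k / 2) * Gamma (real k / 2)))"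
          proof -
            have "v powr (real k / 2 - 1) = v powr (real k / 2) / v"
              using v by (simp add: powr_diff)
            thus ?thesis using v G unfolding psi radial_const_def by (simp add: field_simps)
          qed
          moreover have "0 \<le> \<psi> ((norm x)\<^sup>2 / v) x" using elim v by (intro \<psi>0) simp
          moreover have "0 \<le> radial_const k * norm x powr (- real k)"
            using G by (simp add: radial_const_def)
          ultimately have "ennreal (1 / v) * ennreal (\<psi> ((norm x)\<^sup>2 / v) x) = ennreal (radial_const k * norm x powr (- real k)) *
             ennreal (v powr (real k / 2 - 1) * exp (- v / 2) / (2 powr (real k / 2) * Gamma (real k / 2)))"
            using v G by (simp flip: ennreal_mult)
          thus ?thesis using v by (simp add: mult.assoc[symmetric])
        qed simp
      qed
      also have "\<dots> = ennreal (radial_const k * norm x powr (- real k)) * (\<integral>\<^sup>+v. h ((norm x)\<^sup>2 / v, x) \<partial>chi_squared k)"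
        unfolding chi_squared_def by (subst nn_integral_cmult, simp, subst nn_integral_density) auto
      finally show ?case .
    qed
  qed
  finally show ?thesis .
qed

section \<open>Integrating out location and scale\<close>

lemma nn_integral_lborel_translate:
  fixes f :: "'a::euclidean_space \<Rightarrow> ennreal"
  assumes [measurable]: "f \<in> borel_measurable borel"
  shows "(\<integral>\<^sup>+x. f (x + a) \<partial>lborel) = (\<integral>\<^sup>+x. f x \<partial>lborel)"
proof -
  have "(\<integral>\<^sup>+x. f x \<partial>lborel) = (\<integral>\<^sup>+x. f x \<partial>distr lborel borel ((+) a))"
    by (simp only: lborel_distr_plus)
  also have "\<dots> = (\<integral>\<^sup>+x. f (x + a) \<partial>lborel)"
    by (subst nn_integral_distr) (auto simp: add.commute)
  finally show ?thesis ..
qed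

lemma nn_integral_reference_prior:
  fixes F :: "'a::euclidean_space \<times> real \<Rightarrow> ennreal"
  assumes [measurable]: "F \<in> borel_measurable borel"
  shows "(\<integral>\<^sup>+z. F z \<partial>reference_prior c) =
    (\<integral>\<^sup>+s. indicator {0<..} s * ennreal (c / s) * (\<integral>\<^sup>+\<beta>. F (\<beta>, s) \<partial>lborel) \<partial>lborel)"
proof -
  have S: "UNIV \<times> {0<..} \<in> sets (borel :: ('a \<times> real) measure)"
    by (intro borel_open open_Times) auto
  have [measurable]: "(snd :: 'a \<times> real \<Rightarrow> real) \<in> borel_measurable borel"
    by (simp flip: borel_prod)
  have [measurable]: "(\<lambda>z::'a \<times> real. indicator (UNIV \<times> {0<..}) z :: ennreal) \<in> borel_measurable borel"
    using S by measurable
  have "(\<integral>\<^sup>+z. F z \<partial>reference_prior c) =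
      (\<integral>\<^sup>+z. (case z of (_, s) \<Rightarrow> ennreal (c / s)) * F z \<partial>restrict_space lborel (UNIV \<times> {0<..}))"
    unfolding reference_prior_def
    by (intro nn_integral_density measurable_restrict_space1) (auto simp: split_beta')
  also have "\<dots> = (\<integral>\<^sup>+z. (case z of (_, s) \<Rightarrow> ennreal (c / s)) * F z * indicator (UNIV \<times> {0<..}) z \<partial>lborel)"
    using S by (subst nn_integral_restrict_space) auto
  also have "\<dots> = (\<integral>\<^sup>+z. (case z of (_, s) \<Rightarrow> ennreal (c / s)) * F z * indicator (UNIV \<times> {0<..}) z \<partial>(lborel \<Otimes>\<^sub>M lborel))"
    by (simp add: lborel_prod)
  also have "\<dots> = (\<integral>\<^sup>+s. \<integral>\<^sup>+\<beta>. ennreal (c / s) * F (\<beta>, s) * indicator {0<..} s \<partial>lborel \<partial>lborel)"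
    by (subst lborel_pair.nn_integral_snd[symmetric])
       (auto simp: split_beta' lborel_prod indicator_times intro!: nn_integral_cong)
  also have "\<dots> = (\<integral>\<^sup>+s. indicator {0<..} s * ennreal (c / s) * (\<integral>\<^sup>+\<beta>. F (\<beta>, s) \<partial>lborel) \<partial>lborel)"
    by (intro nn_integral_cong) (simp add: nn_integral_cmult nn_integral_multc mult_ac)
  finally show ?thesis .
qed

text \<open>
  For each realization \<open>e\<close> of the noise the shift \<open>sqrt s \<tau> e\<close> is absorbed by the translation invariance of
  Lebesgue measure. What is left to be integrated over the scale is the pair \<open>(\<xi>, \<rho>)\<close>, whose components
  are independent.
\<close>

theorem nn_integral_location_scale_mixture:
  fixes g :: "'b::euclidean_space \<times> 'x::euclidean_space \<times> 'm::euclidean_space \<Rightarrow> ennreal"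
    and \<tau> :: "'e \<Rightarrow> 'b" and \<xi> :: "'e \<Rightarrow> 'x" and \<rho> :: "'e \<Rightarrow> 'm"
  assumes L: "prob_space L" and R: "prob_space R" "sets R = sets borel"
    and [measurable]: "\<tau> \<in> borel_measurable L" "\<xi> \<in> borel_measurable L" "\<rho> \<in> borel_measurable L"
      "g \<in> borel_measurable borel"
    and indep: "distr L (borel \<Otimes>\<^sub>M borel) (\<lambda>e. (\<xi> e, \<rho> e)) = std_multivariate_normal \<Otimes>\<^sub>M R"
    and c: "c > 0"
  defines "k \<equiv> DIM('x)"
  shows "(\<integral>\<^sup>+(\<beta>, s). (\<integral>\<^sup>+e. g (\<beta> + sqrt s *\<^sub>R \<tau> e, sqrt s *\<^sub>R \<xi> e, sqrt s *\<^sub>R \<rho> e) \<partial>L) \<partial>reference_prior c) =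
    (\<integral>\<^sup>+(\<beta>, x). ennreal (c * radial_const k * norm x powr (- real k)) *
       (\<integral>\<^sup>+(r, v). g (\<beta>, x, (norm x / sqrt v) *\<^sub>R r) \<partial>(R \<Otimes>\<^sub>M chi_squared k)) \<partial>lborel)"
proof -
  have k: "k > 0" by (simp add: k_def)
  interpret L: prob_space L by fact
  interpret R: prob_space R by fact
  interpret S: prob_space "std_multivariate_normal :: 'x measure" by (rule prob_space_std_multivariate_normal)
  interpret X: prob_space "chi_squared k" by (rule prob_space_chi_squared[OF k])
  interpret LB: pair_sigma_finite L "lborel :: 'b measure" ..
  interpret RB: pair_sigma_finite R "lborel :: 'b measure" ..
  interpret RX: pair_sigma_finite R "chi_squared k" ..
  interpret XB: pair_sigma_finite "chi_squared k" "lborel :: 'b measure" ..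
  note [measurable_cong] = R(2)
  have [measurable_cong]: "sets (std_multivariate_normal :: 'x measure) = sets borel"
    by (simp add: std_multivariate_normal_def)
  define H where "H x r = (\<integral>\<^sup>+\<beta>. g (\<beta>, x, r) \<partial>lborel)" for x r
  have [measurable]: "(\<lambda>(x, r). H x r) \<in> borel_measurable (borel \<Otimes>\<^sub>M borel)"
    unfolding H_def by measurable
  have inner: "(\<integral>\<^sup>+\<beta>. \<integral>\<^sup>+e. g (\<beta> + sqrt s *\<^sub>R \<tau> e, sqrt s *\<^sub>R \<xi> e, sqrt s *\<^sub>R \<rho> e) \<partial>L \<partial>lborel) =
      (\<integral>\<^sup>+x. \<integral>\<^sup>+r. H (sqrt s *\<^sub>R x) (sqrt s *\<^sub>R r) \<partial>R \<partial>std_multivariate_normal)" for s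
  proof -
    have "(\<integral>\<^sup>+\<beta>. \<integral>\<^sup>+e. g (\<beta> + sqrt s *\<^sub>R \<tau> e, sqrt s *\<^sub>R \<xi> e, sqrt s *\<^sub>R \<rho> e) \<partial>L \<partial>lborel) =
        (\<integral>\<^sup>+e. \<integral>\<^sup>+\<beta>. g (\<beta> + sqrt s *\<^sub>R \<tau> e, sqrt s *\<^sub>R \<xi> e, sqrt s *\<^sub>R \<rho> e) \<partial>lborel \<partial>L)"
      by (rule LB.Fubini') measurable
    also have "\<dots> = (\<integral>\<^sup>+e. H (sqrt s *\<^sub>R \<xi> e) (sqrt s *\<^sub>R \<rho> e) \<partial>L)"
      unfolding H_def
      by (intro nn_integral_cong nn_integral_lborel_translate[of "\<lambda>\<beta>. g (\<beta>, _, _)"]) measurable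
    also have "\<dots> = (\<integral>\<^sup>+(x, r). H (sqrt s *\<^sub>R x) (sqrt s *\<^sub>R r) \<partial>distr L (borel \<Otimes>\<^sub>M borel) (\<lambda>e. (\<xi> e, \<rho> e)))"
      by (subst nn_integral_distr) auto
    also have "\<dots> = (\<integral>\<^sup>+x. \<integral>\<^sup>+r. H (sqrt s *\<^sub>R x) (sqrt s *\<^sub>R r) \<partial>R \<partial>std_multivariate_normal)"
      unfolding indep by (subst R.nn_integral_fst[symmetric]) auto
    finally show ?thesis .
  qed
  define h where "h = (\<lambda>(s, x). \<integral>\<^sup>+r. H x (sqrt s *\<^sub>R r) \<partial>R)"
  have h[measurable]: "h \<in> borel_measurable borel"
    unfolding h_def borel_prod[symmetric] by measurable
  have mF: "(\<lambda>(\<beta>, s). \<integral>\<^sup>+e. g (\<beta> + sqrt s *\<^sub>R \<tau> e, sqrt s *\<^sub>R \<xi> e, sqrt s *\<^sub>R \<rho> e) \<partial>L) \<in> borel_measurable borel"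
    unfolding borel_prod[symmetric] by measurable
  have "(\<integral>\<^sup>+(\<beta>, s). (\<integral>\<^sup>+e. g (\<beta> + sqrt s *\<^sub>R \<tau> e, sqrt s *\<^sub>R \<xi> e, sqrt s *\<^sub>R \<rho> e) \<partial>L) \<partial>reference_prior c) =
      (\<integral>\<^sup>+s. indicator {0<..} s * ennreal (c / s) * (\<integral>\<^sup>+x. h (s, sqrt s *\<^sub>R x) \<partial>std_multivariate_normal) \<partial>lborel)"
    by (subst nn_integral_reference_prior[OF mF]) (simp add: inner h_def)
  also have "\<dots> = (\<integral>\<^sup>+s. ennreal c * (indicator {0<..} s * ennreal (1 / s) * (\<integral>\<^sup>+x. h (s, sqrt s *\<^sub>R x) \<partial>std_multivariate_normal)) \<partial>lborel)"
  proof (intro nn_integral_cong)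
    fix s :: real
    have "ennreal (c / s) = ennreal c * ennreal (1 / s)" if "s > 0"
      using that c by (simp flip: ennreal_mult)
    thus "indicator {0<..} s * ennreal (c / s) * (\<integral>\<^sup>+x. h (s, sqrt s *\<^sub>R x) \<partial>std_multivariate_normal) =
      ennreal c * (indicator {0<..} s * ennreal (1 / s) * (\<integral>\<^sup>+x. h (s, sqrt s *\<^sub>R x) \<partial>std_multivariate_normal))"
      by (cases "s > 0") (auto simp: mult_ac)
  qed
  also have "\<dots> = ennreal c * (\<integral>\<^sup>+x. ennreal (radial_const k * norm x powr (- real k)) *
        (\<integral>\<^sup>+v. h ((norm x)\<^sup>2 / v, x) \<partial>chi_squared k) \<partial>lborel)"
    unfolding k_def by (subst nn_integral_scale_mixture[OF h, symmetric], rule nn_integral_cmult) measurable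
  also have "\<dots> = (\<integral>\<^sup>+x. ennreal c * (ennreal (radial_const k * norm x powr (- real k)) *
        (\<integral>\<^sup>+v. h ((norm x)\<^sup>2 / v, x) \<partial>chi_squared k)) \<partial>lborel)"
    by (rule nn_integral_cmult[symmetric]) measurable
  also have "\<dots> = (\<integral>\<^sup>+x. \<integral>\<^sup>+\<beta>. ennreal (c * radial_const k * norm x powr (- real k)) *
       (\<integral>\<^sup>+(r, v). g (\<beta>, x, (norm x / sqrt v) *\<^sub>R r) \<partial>(R \<Otimes>\<^sub>M chi_squared k)) \<partial>lborel \<partial>lborel)"
  proof (intro nn_integral_cong)
    fix x :: 'x
    have "(\<integral>\<^sup>+v. h ((norm x)\<^sup>2 / v, x) \<partial>chi_squared k) =
        (\<integral>\<^sup>+v. \<integral>\<^sup>+r. \<integral>\<^sup>+\<beta>. g (\<beta>, x, (norm x / sqrt v) *\<^sub>R r) \<partial>lborel \<partial>R \<partial>chi_squared k)"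
      by (simp add: h_def H_def real_sqrt_divide)
    also have "\<dots> = (\<integral>\<^sup>+v. \<integral>\<^sup>+\<beta>. \<integral>\<^sup>+r. g (\<beta>, x, (norm x / sqrt v) *\<^sub>R r) \<partial>R \<partial>lborel \<partial>chi_squared k)"
      by (intro nn_integral_cong RB.Fubini'[symmetric]) measurable
    also have "\<dots> = (\<integral>\<^sup>+\<beta>. \<integral>\<^sup>+v. \<integral>\<^sup>+r. g (\<beta>, x, (norm x / sqrt v) *\<^sub>R r) \<partial>R \<partial>chi_squared k \<partial>lborel)"
      by (rule XB.Fubini'[symmetric]) measurable
    also have "\<dots> = (\<integral>\<^sup>+\<beta>. (\<integral>\<^sup>+(r, v). g (\<beta>, x, (norm x / sqrt v) *\<^sub>R r) \<partial>(R \<Otimes>\<^sub>M chi_squared k)) \<partial>lborel)"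
      by (intro nn_integral_cong, subst RX.nn_integral_snd[symmetric]) auto
    finally have "(\<integral>\<^sup>+v. h ((norm x)\<^sup>2 / v, x) \<partial>chi_squared k) = \<dots>" .
    moreover have "ennreal c * (ennreal (radial_const k * norm x powr (- real k)) * z) =
        ennreal (c * radial_const k * norm x powr (- real k)) * z" for z
      using c by (simp add: ennreal_mult' mult.assoc)
    ultimately show "ennreal c * (ennreal (radial_const k * norm x powr (- real k)) *
        (\<integral>\<^sup>+v. h ((norm x)\<^sup>2 / v, x) \<partial>chi_squared k)) =
      (\<integral>\<^sup>+\<beta>. ennreal (c * radial_const k * norm x powr (- real k)) *
       (\<integral>\<^sup>+(r, v). g (\<beta>, x, (norm x / sqrt v) *\<^sub>R r) \<partial>(R \<Otimes>\<^sub>M chi_squared k)) \<partial>lborel)"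
      by (simp add: nn_integral_cmult)
  qed
  also have "\<dots> = (\<integral>\<^sup>+(\<beta>, x). ennreal (c * radial_const k * norm x powr (- real k)) *
       (\<integral>\<^sup>+(r, v). g (\<beta>, x, (norm x / sqrt v) *\<^sub>R r) \<partial>(R \<Otimes>\<^sub>M chi_squared k)) \<partial>(lborel \<Otimes>\<^sub>M lborel))"
    by (subst lborel_pair.nn_integral_snd[symmetric]) (auto simp: split_beta')
  finally show ?thesis by (simp only: lborel_prod)
qed

section \<open>Matrices and quadratic forms\<close>

declare transpose_matrix_vector [simp del]

text \<open>
  Gram-Schmidt for the inner product \<open>u \<bullet> C v\<close> gives a basis that is orthonormal with respect to it, and
  \<open>T\<close> maps the standard basis to that basis.
\<close>

lemma ex_whitening:
  fixes C :: "'a::euclidean_space \<Rightarrow> 'a"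
  assumes C: "linear C" and sym: "\<And>u v. u \<bullet> C v = C u \<bullet> v"
    and pos: "\<And>u. u \<noteq> 0 \<Longrightarrow> 0 < u \<bullet> C u"
  shows "\<exists>T :: 'a \<Rightarrow> 'a. linear T \<and> (\<forall>u v. T u \<bullet> C (T v) = u \<bullet> v)"
proof -
  interpret C: linear C by fact
  have "\<exists>S::'a set. finite S \<and> card S = k \<and> (\<forall>u\<in>S. \<forall>v\<in>S. u \<bullet> C v = (if u = v then 1 else 0))"
    if "k \<le> DIM('a)" for k
    using that
  proof (induction k)
    case 0
    show ?case by (intro exI[of _ "{}"]) simp
  next
    case (Suc k)
    then obtain S :: "'a set" where S: "finite S" "card S = k"
      "\<And>u v. u \<in> S \<Longrightarrow> v \<in> S \<Longrightarrow> u \<bullet> C v = (if u = v then 1 else 0)"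
      by (metis Suc_leD)
    have "span S \<noteq> UNIV"
      using dim_le_card'[OF S(1)] S(2) Suc.prems by (metis Suc_n_not_le_n dim_UNIV dim_span le_trans)
    then obtain x where x: "x \<notin> span S" by blast
    define z where "z = x - (\<Sum>s\<in>S. (s \<bullet> C x) *\<^sub>R s)"
    have "(\<Sum>s\<in>S. (s \<bullet> C x) *\<^sub>R s) \<in> span S"
      by (intro span_sum span_scale span_base)
    hence z0: "z \<noteq> 0" using x by (auto simp: z_def)
    have orth: "u \<bullet> C z = 0" if "u \<in> S" for u
    proof -
      have "u \<bullet> C z = u \<bullet> C x - (\<Sum>s\<in>S. (s \<bullet> C x) * (u \<bullet> C s))"
        by (simp add: z_def C.diff C.sum C.scale inner_diff_right inner_sum_right)
      also have "(\<Sum>s\<in>S. (s \<bullet> C x) * (u \<bullet> C s)) = (\<Sum>s\<in>S. if s = u then s \<bullet> C x else 0)"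
        by (intro sum.cong refl) (auto simp: S(3) that)
      finally show ?thesis using S(1) that by simp
    qed
    define y where "y = z /\<^sub>R sqrt (z \<bullet> C z)"
    have y1: "y \<bullet> C y = 1" using pos[OF z0] by (simp add: y_def C.scale field_simps flip: power2_eq_square)
    have yS: "u \<bullet> C y = 0" "y \<bullet> C u = 0" if "u \<in> S" for u
      using orth[OF that] sym[of y u] by (auto simp: y_def C.scale inner_commute)
    have "y \<notin> S" using yS(1)[of y] y1 by auto
    thus ?case using S yS y1 by (intro exI[of _ "insert y S"]) auto
  qed
  from this[of "DIM('a)"] obtain S :: "'a set" where S: "finite S" "card S = card (Basis :: 'a set)"
      "\<And>u v. u \<in> S \<Longrightarrow> v \<in> S \<Longrightarrow> u \<bullet> C v = (if u = v then 1 else 0)" by auto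
  obtain f where f: "bij_betw f (Basis :: 'a set) S"
    using finite_same_card_bij[OF finite_Basis S(1)] S(2) by metis
  define T where "T u = (\<Sum>b\<in>Basis. (u \<bullet> b) *\<^sub>R f b)" for u :: 'a
  have "linear T"
    by (rule linearI) (simp_all add: T_def inner_add_left scaleR_add_left sum.distrib scaleR_sum_right)
  moreover have "T u \<bullet> C (T v) = u \<bullet> v" for u v
  proof -
    have ff: "f b \<bullet> C (f b') = (if b = b' then 1 else 0)" if "b \<in> Basis" "b' \<in> Basis" for b b'
      using f that S(3)[of "f b" "f b'"] by (auto simp: bij_betw_def inj_on_def)
    have "T u \<bullet> C (T v) = (\<Sum>b\<in>Basis. \<Sum>b'\<in>Basis. (u \<bullet> b) * (v \<bullet> b') * (f b \<bullet> C (f b')))"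
      by (simp add: T_def C.sum C.scale inner_sum_left inner_sum_right sum_distrib_left,
          subst sum.swap, simp add: mult_ac)
    also have "\<dots> = (\<Sum>b\<in>Basis. \<Sum>b'\<in>Basis. if b' = b then (u \<bullet> b) * (v \<bullet> b') else 0)"
      by (intro sum.cong refl) (auto simp: ff)
    also have "\<dots> = u \<bullet> v" by (subst (2) euclidean_inner) simp
    finally show ?thesis .
  qed
  ultimately show ?thesis by blast
qed

lemma inner_matrix_mult:
  fixes A :: "real ^ 'n ^ 'm"
  shows "x \<bullet> (A *v y) = (transpose A *v x) \<bullet> y"
  by (simp add: transpose_matrix_vector dot_lmul_matrix)

lemma matrix_eqI_inner:
  fixes A B :: "real ^ 'n ^ 'm"
  assumes "\<And>x y. x \<bullet> (A *v y) = x \<bullet> (B *v y)"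
  shows "A = B"
  unfolding matrix_eq using assms by (auto intro: vector_eq_ldot[THEN iffD1])

text \<open>
  Multiplying \<open>P P\<^sup>T + W W\<^sup>T = 1\<close> by \<open>H\<close> or by \<open>W\<close> kills one of the two terms, because the column spaces are
  orthogonal. Full rank then allows cancelling the remaining left factor.
\<close>

lemma complementary_frame:
  fixes H P :: "real ^ 'p ^ 'n" and W :: "real ^ 'q ^ 'n"
  assumes H: "rank H = CARD('p)"
    and P: "rank P = CARD('p)" "span (columns P) = span (columns H)"
    and W: "rank W = CARD('q)" "span (columns W) = orthogonal_comp (span (columns H))"
    and PW: "P ** transpose P + W ** transpose W = mat 1"
  shows "transpose W ** H = 0" "transpose P ** W = 0" "transpose W ** W = mat 1"
    "P ** transpose P ** H = H" "invertible (transpose P ** H)"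
proof -
  have col: "A *v x \<in> span (columns A)" for A :: "real ^ 'k ^ 'n" and x
    by (rule matrix_vector_mult_in_columnspace)
  have orth: "(W *v u) \<bullet> y = 0" if "y \<in> span (columns H)" for u y
    using col[of W u] that unfolding W(2) orthogonal_comp_def orthogonal_def
    by (auto simp: inner_commute)
  show WH: "transpose W ** H = 0"
  proof (rule matrix_eqI_inner)
    show "x \<bullet> ((transpose W ** H) *v y) = x \<bullet> (0 *v y)" for x y
      using orth[OF col[of H y], of x]
      by (simp add: matrix_vector_mul_assoc[symmetric] inner_matrix_mult[of _ "transpose W"])
  qed
  show PtW: "transpose P ** W = 0"
  proof (rule matrix_eqI_inner)
    show "x \<bullet> ((transpose P ** W) *v y) = x \<bullet> (0 *v y)" for x y
      using orth[of "P *v x" y] col[of P x] P(2)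
      by (simp add: matrix_vector_mul_assoc[symmetric] inner_matrix_mult[of _ "transpose P"] inner_commute)
  qed
  have resolve: "P *v (transpose P *v x) + W *v (transpose W *v x) = x" for x
    using arg_cong[OF PW, of "\<lambda>A. A *v x"]
    by (simp add: matrix_vector_mul_assoc matrix_vector_mult_add_rdistrib)
  have PtW': "transpose P *v (W *v x) = 0" for x
    using PtW by (simp add: matrix_vector_mul_assoc)
  have WH': "transpose W *v (H *v x) = 0" for x
    using WH by (simp add: matrix_vector_mul_assoc)
  have "inj ((*v) W)" using W(1) full_rank_injective by blast
  moreover have "W *v (transpose W *v (W *v x)) = W *v x" for x
    using resolve[of "W *v x"] PtW'[of x] by simp
  ultimately have "transpose W *v (W *v x) = x" for x by (auto dest: injD)
  thus "transpose W ** W = mat 1"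
    by (simp add: matrix_eq matrix_vector_mul_assoc[symmetric])
  have PPH: "P *v (transpose P *v (H *v x)) = H *v x" for x
    using resolve[of "H *v x"] WH'[of x] by simp
  thus "P ** transpose P ** H = H"
    by (simp add: matrix_eq matrix_vector_mul_assoc[symmetric])
  have "inj ((*v) (transpose P ** H))"
  proof (rule injI)
    fix x y assume "(transpose P ** H) *v x = (transpose P ** H) *v y"
    hence "H *v x = H *v y"
      by (metis PPH matrix_vector_mul_assoc)
    moreover have "inj ((*v) H)" using H full_rank_injective by blast
    ultimately show "x = y" by (rule injD[rotated])
  qed
  thus "invertible (transpose P ** H)"
    by (simp add: invertible_left_inverse matrix_left_invertible_injective)
qed

lemma matrix_inv_cancel:
  assumes "invertible (A :: real ^ 'n ^ 'n)"
  shows "A *v (matrix_inv A *v x) = x" "matrix_inv A *v (A *v x) = x"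
proof -
  have "A ** matrix_inv A = mat 1 \<and> matrix_inv A ** A = mat 1"
    using assms unfolding invertible_def matrix_inv_def by (rule someI_ex)
  thus "A *v (matrix_inv A *v x) = x" "matrix_inv A *v (A *v x) = x"
    by (simp_all add: matrix_vector_mul_assoc)
qed

text \<open>
  If \<open>x \<bullet> A x = 0\<close> and \<open>y = A x\<close> were nonzero, the quadratic \<open>t \<mapsto> (x + t y) \<bullet> A (x + t y)\<close> would vanish
  at 0 with positive slope \<open>2 y \<bullet> y\<close>, and so it would be negative for small negative \<open>t\<close>.
\<close>

lemma psd_invertible_imp_pos:
  fixes A :: "real ^ 'n ^ 'n"
  assumes A: "invertible A" "transpose A = A" and psd: "\<And>x. 0 \<le> x \<bullet> (A *v x)" and x: "x \<noteq> 0"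
  shows "0 < x \<bullet> (A *v x)"
proof (rule ccontr)
  assume "\<not> ?thesis"
  hence 0: "x \<bullet> (A *v x) = 0" using psd[of x] by simp
  define y where "y = A *v x"
  have "y \<noteq> 0" using matrix_inv_cancel(2)[OF A(1), of x] x by (auto simp: y_def)
  hence a: "y \<bullet> y > 0" by simp
  define b where "b = y \<bullet> (A *v y)"
  have b: "b \<ge> 0" using psd by (simp add: b_def)
  have xy: "x \<bullet> (A *v y) = y \<bullet> y" using A(2) by (simp add: inner_matrix_mult y_def)
  have q: "0 \<le> 2 * t * (y \<bullet> y) + t\<^sup>2 * b" for t
    using psd[of "x + t *\<^sub>R y"] 0 xy
    by (simp add: matrix_vector_right_distrib matrix_vector_mult_scaleR inner_add_left inner_add_right
        b_def power2_eq_square algebra_simps flip: y_def)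
  \<comment> \<open>The denominator \<open>b + 1\<close> keeps the quotient meaningful when \<open>b = 0\<close>.\<close>
  define t where "t = - (y \<bullet> y) / (b + 1)"
  have t: "t < 0" "t * (b + 1) = - (y \<bullet> y)" using a b by (auto simp: t_def)
  have "2 * t * (y \<bullet> y) + t\<^sup>2 * b = t * (2 * (y \<bullet> y) + t * (b + 1) - t)"
    by (simp add: power2_eq_square algebra_simps)
  also have "\<dots> = t * (y \<bullet> y - t)" using t(2) by simp
  also have "\<dots> < 0" using t(1) a by (intro mult_neg_pos) linarith+
  finally show False using q[of t] by simp
qed

text \<open>
  The congruence \<open>N\<^sup>T G N = 1\<close> makes \<open>N N\<^sup>T\<close> the inverse of \<open>G\<close>, so one matrix \<open>N\<close> both whitens a Gaussian vector
  with covariance \<open>G\<close> and factors the precision matrix.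
\<close>

lemma ex_matrix_whitening:
  fixes G :: "real ^ 'q ^ 'q"
  assumes sym: "transpose G = G" and pos: "\<And>x. x \<noteq> 0 \<Longrightarrow> 0 < x \<bullet> (G *v x)"
  obtains N :: "real ^ 'q ^ 'q" where "matrix_inv G = N ** transpose N" "transpose N ** (G ** N) = mat 1"
proof -
  have "u \<bullet> (G *v v) = (G *v u) \<bullet> v" for u v using sym by (simp add: inner_matrix_mult)
  then obtain T :: "real ^ 'q \<Rightarrow> real ^ 'q"
    where T: "linear T" "\<And>u v. T u \<bullet> (G *v T v) = u \<bullet> v"
    using ex_whitening[of "(*v) G", OF matrix_vector_mul_linear] pos by blast
  define N where "N = matrix T"
  have N: "N *v u = T u" for u unfolding N_def using fun_cong[OF matrix_vector_mul(2)[OF T(1)], of u] by simp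
  have 1: "transpose N ** (G ** N) = mat 1"
    by (rule matrix_eqI_inner)
       (simp add: matrix_vector_mul_assoc[symmetric] inner_matrix_mult[of _ "transpose N"] N T(2))
  hence "(G ** N) ** transpose N = mat 1" using matrix_left_right_inverse by blast
  hence 2: "G ** (N ** transpose N) = mat 1" by (simp add: matrix_mul_assoc)
  hence inv: "invertible G" using invertible_right_inverse by blast
  have "matrix_inv G = N ** transpose N"
    unfolding matrix_eq
  proof
    fix x
    have "G *v ((N ** transpose N) *v x) = x" using 2 by (simp add: matrix_vector_mul_assoc)
    thus "matrix_inv G *v x = (N ** transpose N) *v x"
      using matrix_inv_cancel(2)[OF inv] by metis
  qed
  thus ?thesis using that 1 by blast
qed

section \<open>Residual decomposition of a Gaussian pair\<close>

lemma transpose_add: "transpose (A + B) = transpose A + transpose (B :: real ^ 'n ^ 'm)"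
  by (vector transpose_def)

lemma transpose_diff: "transpose (A - B) = transpose A - transpose (B :: real ^ 'n ^ 'm)"
  by (vector transpose_def)

text \<open>
  The covariance operator of the pair of an observed and an unobserved vector, with the cross-covariance
  \<open>B\<close> of the second with the first.
\<close>

abbreviation block_operator ::
  "real ^ 'n ^ 'n \<Rightarrow> real ^ 'n ^ 'm \<Rightarrow> real ^ 'm ^ 'm \<Rightarrow> (real ^ 'n) \<times> (real ^ 'm) \<Rightarrow> (real ^ 'n) \<times> (real ^ 'm)"
  where "block_operator A B D \<equiv> (\<lambda>(u, v). (A *v u + transpose B *v v, B *v u + D *v v))"

lemma block_operator_symmetric_imp:
  assumes "\<And>u v. u \<bullet> block_operator \<Sigma> \<Sigma>0 \<Sigma>00 v = block_operator \<Sigma> \<Sigma>0 \<Sigma>00 u \<bullet> v"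
  shows "transpose \<Sigma> = \<Sigma>" "transpose \<Sigma>00 = \<Sigma>00"
proof -
  show "transpose \<Sigma> = \<Sigma>"
  proof (rule matrix_eqI_inner)
    show "x \<bullet> (transpose \<Sigma> *v y) = x \<bullet> (\<Sigma> *v y)" for x y
      using assms[of "(x, 0)" "(y, 0)"] by (simp add: inner_matrix_mult)
  qed
  show "transpose \<Sigma>00 = \<Sigma>00"
  proof (rule matrix_eqI_inner)
    show "x \<bullet> (transpose \<Sigma>00 *v y) = x \<bullet> (\<Sigma>00 *v y)" for x y
      using assms[of "(0, x)" "(0, y)"] by (simp add: inner_matrix_mult)
  qed
qed

text \<open>
  The vector \<open>t\<close> is the image of \<open>(a, b)\<close> under the adjoint of
  \<open>(\<epsilon>, \<epsilon>0) \<mapsto> (N\<^sup>T W\<^sup>T \<epsilon>, \<epsilon>0 - D \<epsilon>)\<close>, so the left-hand side is the variance of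
  \<open>a \<bullet> \<xi> + b \<bullet> \<rho>\<close> for the whitened residual \<open>\<xi>\<close> and the prediction error \<open>\<rho>\<close>. The absence of a term
  mixing \<open>a\<close> and \<open>b\<close> says that \<open>\<xi>\<close> and \<open>\<rho>\<close> are uncorrelated: \<open>D\<close> is \<open>A\<close> corrected by the
  regression on \<open>W\<^sup>T \<epsilon>\<close>, and the correction completes the square.
\<close>

lemma residual_quadratic_form:
  fixes \<Sigma> :: "real ^ 'n ^ 'n" and \<Sigma>0 A :: "real ^ 'n ^ 'm" and \<Sigma>00 :: "real ^ 'm ^ 'm"
    and W :: "real ^ 'q ^ 'n" and N :: "real ^ 'q ^ 'q"
  assumes sym: "transpose \<Sigma> = \<Sigma>"
    and N: "transpose N ** (transpose W ** \<Sigma> ** W ** N) = mat 1"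
    and S: "S = (A ** \<Sigma> - \<Sigma>0) ** W"
    and D: "D = A - S ** (N ** transpose N) ** transpose W"
    and R: "R = (\<Sigma>00 + A ** \<Sigma> ** transpose A - A ** transpose \<Sigma>0 - \<Sigma>0 ** transpose A)
        - S ** (N ** transpose N) ** transpose S"
    and t: "t = (W *v (N *v a) - transpose D *v b, b)"
  shows "t \<bullet> block_operator \<Sigma> \<Sigma>0 \<Sigma>00 t = a \<bullet> a + b \<bullet> (R *v b)"
proof -
  note assoc = matrix_vector_mul_assoc[symmetric]
  define e where "e = transpose N *v (transpose S *v b)"
  \<comment> \<open>The square is completed by \<open>d = a + e\<close>, the correction \<open>e\<close> coming from the regression part of \<open>D\<close>.\<close>
  define d where "d = a + e"
  define x where "x = W *v (N *v d)"
  define y where "y = transpose A *v b"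
  have t': "t = (x - y, b)"
    by (simp add: t D x_def y_def d_def e_def transpose_diff matrix_transpose_mul assoc
        matrix_vector_mult_diff_rdistrib matrix_vector_right_distrib)
  have symI: "u \<bullet> (\<Sigma> *v v) = v \<bullet> (\<Sigma> *v u)" for u v
    using sym by (metis inner_commute inner_matrix_mult)
  have "x \<bullet> (\<Sigma> *v x) = d \<bullet> ((transpose N ** (transpose W ** \<Sigma> ** W ** N)) *v d)"
    by (simp add: x_def assoc inner_matrix_mult[of d] inner_matrix_mult[of _ "transpose W"])
  hence xx: "x \<bullet> (\<Sigma> *v x) = d \<bullet> d" by (simp add: N)
  have ed: "e \<bullet> d = y \<bullet> (\<Sigma> *v x) - b \<bullet> (\<Sigma>0 *v x)"
  proof -
    have "e \<bullet> d = b \<bullet> (S *v (N *v d))"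
      by (simp add: e_def inner_matrix_mult)
    thus ?thesis
      by (simp add: S x_def y_def assoc matrix_vector_mult_diff_rdistrib inner_diff_right inner_matrix_mult[of b A])
  qed
  have "b \<bullet> ((S ** (N ** transpose N) ** transpose S) *v b) = e \<bullet> e"
    by (simp add: e_def assoc inner_matrix_mult[of b S] inner_matrix_mult[of _ N])
  moreover have "b \<bullet> ((A ** \<Sigma> ** transpose A) *v b) = y \<bullet> (\<Sigma> *v y)"
    by (simp add: y_def assoc inner_matrix_mult[of b A])
  moreover have "b \<bullet> ((\<Sigma>0 ** transpose A) *v b) = b \<bullet> (\<Sigma>0 *v y)"
    by (simp add: y_def assoc)
  moreover have "b \<bullet> ((A ** transpose \<Sigma>0) *v b) = b \<bullet> (\<Sigma>0 *v y)"
    by (simp add: y_def assoc inner_matrix_mult[of b A] inner_matrix_mult[of _ "transpose \<Sigma>0"] inner_commute)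
  ultimately have Rb: "b \<bullet> (R *v b) = b \<bullet> (\<Sigma>00 *v b) + y \<bullet> (\<Sigma> *v y) - 2 * (b \<bullet> (\<Sigma>0 *v y)) - e \<bullet> e"
    by (simp add: R matrix_vector_mult_diff_rdistrib matrix_vector_mult_add_rdistrib inner_diff_right inner_add_right)
  have cross: "u \<bullet> (transpose \<Sigma>0 *v b) = b \<bullet> (\<Sigma>0 *v u)" for u
    by (metis inner_commute inner_matrix_mult)
  have "t \<bullet> block_operator \<Sigma> \<Sigma>0 \<Sigma>00 t = x \<bullet> (\<Sigma> *v x) - 2 * (y \<bullet> (\<Sigma> *v x)) + y \<bullet> (\<Sigma> *v y)
      + 2 * (b \<bullet> (\<Sigma>0 *v x)) - 2 * (b \<bullet> (\<Sigma>0 *v y)) + b \<bullet> (\<Sigma>00 *v b)"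
    by (simp add: t' inner_add_right inner_diff_left inner_diff_right cross matrix_vector_mult_diff_distrib symI[of x y])
  also have "\<dots> = d \<bullet> d - 2 * (e \<bullet> d) + e \<bullet> e + b \<bullet> (R *v b)"
    unfolding xx ed Rb by simp
  also have "\<dots> = a \<bullet> a + b \<bullet> (R *v b)"
    by (simp add: d_def inner_add_left inner_add_right inner_commute)
  finally show ?thesis .
qed

text \<open>
  The quadratic form of the pair separates, hence its characteristic function is a product; by uniqueness
  the joint law is a product measure.
\<close>

lemma gaussian_residual_decomposition:
  fixes \<Sigma> :: "real ^ 'n ^ 'n" and \<Sigma>0 A :: "real ^ 'n ^ 'm" and \<Sigma>00 :: "real ^ 'm ^ 'm"
    and W :: "real ^ 'q ^ 'n" and N :: "real ^ 'q ^ 'q"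
  assumes L: "multivariate_normal 0 (block_operator \<Sigma> \<Sigma>0 \<Sigma>00) L"
    and N: "transpose N ** (transpose W ** \<Sigma> ** W ** N) = mat 1"
    and S: "S = (A ** \<Sigma> - \<Sigma>0) ** W"
    and D: "D = A - S ** (N ** transpose N) ** transpose W"
    and R: "R = (\<Sigma>00 + A ** \<Sigma> ** transpose A - A ** transpose \<Sigma>0 - \<Sigma>0 ** transpose A)
        - S ** (N ** transpose N) ** transpose S"
  defines "\<nu> \<equiv> distr L borel (\<lambda>e. snd e - D *v fst e)"
  shows "multivariate_normal 0 ((*v) R) \<nu>"
    "distr L (borel \<Otimes>\<^sub>M borel) (\<lambda>e. (transpose N *v (transpose W *v fst e), snd e - D *v fst e))
      = std_multivariate_normal \<Otimes>\<^sub>M \<nu>"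
proof -
  let ?C = "block_operator \<Sigma> \<Sigma>0 \<Sigma>00"
  have L': "prob_space L" "sets L = sets borel" and Csym: "\<And>u v. u \<bullet> ?C v = ?C u \<bullet> v"
    using L by (auto simp: multivariate_normal_def)
  note sym = block_operator_symmetric_imp[OF Csym]
  define T where "T = (\<lambda>e. (transpose N *v (transpose W *v fst e), snd e - D *v fst e))"
  define T2 where "T2 = (\<lambda>e. snd e - D *v fst e)"
  have lin: "linear T" "linear T2"
    unfolding T_def T2_def
    by (rule linearI; simp add: matrix_vector_right_distrib matrix_vector_mult_scaleR scaleR_diff_right)+
  have adjT: "adjoint T = (\<lambda>(a, b). (W *v (N *v a) - transpose D *v b, b))"
  proof (rule adjoint_unique, intro allI)
    fix x y
    show "T x \<bullet> y = x \<bullet> (case y of (a, b) \<Rightarrow> (W *v (N *v a) - transpose D *v b, b))"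
      by (cases x; cases y) (simp add: T_def inner_diff_left inner_diff_right inner_matrix_mult)
  qed
  have adjT2: "adjoint T2 = (\<lambda>b. (- (transpose D *v b), b))"
  proof (rule adjoint_unique, intro allI)
    fix x y
    show "T2 x \<bullet> y = x \<bullet> (- (transpose D *v y), y)"
      by (cases x) (simp add: T2_def inner_diff_left inner_matrix_mult)
  qed
  note quad = residual_quadratic_form[OF sym(1) N S D R refl]
  have "transpose R = R"
    by (simp add: R transpose_add transpose_diff matrix_transpose_mul matrix_mul_assoc sym)
  hence Rsym: "u \<bullet> (R *v v) = (R *v u) \<bullet> v" for u v by (simp add: inner_matrix_mult)
  show \<nu>: "multivariate_normal 0 ((*v) R) \<nu>"
    unfolding \<nu>_def T2_def[symmetric]
  proof (rule multivariate_normal_linear_image[OF L lin(2) matrix_vector_mul_linear Rsym])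
    show "b \<bullet> (R *v b) = adjoint T2 b \<bullet> ?C (adjoint T2 b)" for b
      using quad[of 0 b] by (simp add: adjT2)
  qed
  have \<nu>': "prob_space \<nu>" "sets \<nu> = sets borel" using \<nu> by (auto simp: multivariate_normal_def)
  have s: "sets (std_multivariate_normal :: (real ^ 'q) measure) = sets borel" by (simp add: std_multivariate_normal_def)
  interpret \<nu>: prob_space \<nu> by fact
  interpret S: prob_space "std_multivariate_normal :: (real ^ 'q) measure" by (rule prob_space_std_multivariate_normal)
  interpret P: pair_prob_space "std_multivariate_normal :: (real ^ 'q) measure" \<nu> ..
  have Tm: "T \<in> borel_measurable L"
    using lin(1) L'(2) measurable_cong_sets[OF L'(2) refl]
    by (auto intro!: borel_measurable_continuous_onI linear_continuous_on linear_conv_bounded_linear[THEN iffD1])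
  have "distr L borel (\<lambda>x. 0 + T x) = std_multivariate_normal \<Otimes>\<^sub>M \<nu>"
  proof (rule multivariate_char_uniqueness)
    show "prob_space (distr L borel (\<lambda>x. 0 + T x))"
      using Tm by (intro prob_space.prob_space_distr L') simp
    show "sets ((std_multivariate_normal :: (real ^ 'q) measure) \<Otimes>\<^sub>M \<nu>) = sets borel"
      using sets_pair_measure_cong[OF s \<nu>'(2)] by (simp only: borel_prod)
    fix t :: "(real ^ 'q) \<times> (real ^ 'm)"
    obtain a b where t: "t = (a, b)" by (cases t)
    have "multivariate_char (distr L borel (\<lambda>x. 0 + T x)) t = multivariate_char L (adjoint T t)"
      by (subst multivariate_char_distr_linear[OF lin(1) L'(2)]) simp
    also have "\<dots> = exp (- complex_of_real (a \<bullet> a + b \<bullet> (R *v b)) / 2)"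
      using quad[of a b] unfolding t adjT
      by (subst multivariate_char_multivariate_normal[OF L]) (simp add: add_divide_distrib diff_divide_distrib)
    also have "\<dots> = exp (- complex_of_real (a \<bullet> a) / 2) * exp (- complex_of_real (b \<bullet> (R *v b)) / 2)"
      by (simp add: exp_add[symmetric] add_divide_distrib diff_divide_distrib)
    also have "\<dots> = multivariate_char std_multivariate_normal a * multivariate_char \<nu> b"
      by (simp add: multivariate_char_std_multivariate_normal multivariate_char_multivariate_normal[OF \<nu>] flip: exp_of_real)
    also have "\<dots> = multivariate_char (std_multivariate_normal \<Otimes>\<^sub>M \<nu>) t"
      unfolding t by (rule multivariate_char_pair[symmetric]) (use s \<nu>' in \<open>auto intro: prob_space_std_multivariate_normal\<close>)
    finally show "multivariate_char (distr L borel (\<lambda>x. 0 + T x)) t = multivariate_char (std_multivariate_normal \<Otimes>\<^sub>M \<nu>) t" .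
  qed (simp_all add: P.prob_space_axioms)
  thus "distr L (borel \<Otimes>\<^sub>M borel) (\<lambda>e. (transpose N *v (transpose W *v fst e), snd e - D *v fst e))
      = std_multivariate_normal \<Otimes>\<^sub>M \<nu>"
    by (simp add: T_def borel_prod)
qed

text \<open>
  A Gaussian law is determined by its mean and its covariance, so every law of the model is an affine image of the
  centred law with unit scale. This gives the measurable dependence on the parameters and a noise variable
  common to all of them.
\<close>

lemma location_scale_law:
  fixes m :: "'a::euclidean_space"
  assumes L: "multivariate_normal 0 C L" and M: "multivariate_normal m (\<lambda>x. s *\<^sub>R C x) M" and s: "s > 0"
  shows "M = distr L borel (\<lambda>x. m + sqrt s *\<^sub>R x)"
proof (rule multivariate_char_uniqueness)
  have C: "linear C" and L': "prob_space L" "sets L = sets borel"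
    using L by (auto simp: multivariate_normal_def)
  show "prob_space M" "sets M = sets borel" using M by (auto simp: multivariate_normal_def)
  have [measurable_cong]: "sets L = sets borel" by fact
  show "prob_space (distr L borel (\<lambda>x. m + sqrt s *\<^sub>R x))"
    by (intro prob_space.prob_space_distr L') measurable
  fix t
  have adj: "adjoint (\<lambda>x::'a. sqrt s *\<^sub>R x) = (\<lambda>x. sqrt s *\<^sub>R x)"
    by (rule adjoint_unique) simp
  have "multivariate_char (distr L borel (\<lambda>x. m + sqrt s *\<^sub>R x)) t = iexp (t \<bullet> m) * multivariate_char L (sqrt s *\<^sub>R t)"
    by (subst multivariate_char_distr_linear[OF linear_scale_self L'(2)]) (simp add: adj)
  also have "\<dots> = iexp (t \<bullet> m) * exp (- (complex_of_real (s * (t \<bullet> C t)) / 2))"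
    using s by (subst multivariate_char_multivariate_normal[OF L]) (simp add: linear_cmul[OF C] flip: mult.assoc of_real_mult)
  also have "\<dots> = multivariate_char M t"
    by (subst multivariate_char_multivariate_normal[OF M]) (simp add: exp_add[symmetric])
  finally show "multivariate_char M t = multivariate_char (distr L borel (\<lambda>x. m + sqrt s *\<^sub>R x)) t" ..
qed simp

lemma multivariate_normal_covariance_nonneg:
  assumes "multivariate_normal m C M"
  shows "0 \<le> u \<bullet> C u"
proof -
  have "univariate_normal (u \<bullet> m) (u \<bullet> C u) (distr M borel (\<lambda>x. u \<bullet> x))"
    using assms unfolding multivariate_normal_def by blast
  thus ?thesis by (auto simp: univariate_normal_def split: if_splits)
qed

section \<open>Student laws and conditional distributions\<close>

text \<open>
  The Student law of scale matrix \<open>(q / k) R\<close> draws its Gaussian part with that covariance, here realized as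
  \<open>sqrt (q / k) r\<close> with \<open>r\<close> of covariance \<open>R\<close>. The factor \<open>k\<close> cancels against \<open>sqrt (k / v)\<close>.
  The case \<open>q = 0\<close> gives the point mass at \<open>m\<close>.
\<close>

lemma multivariate_student_scale_mixture:
  fixes R :: "real ^ 'm ^ 'm"
  assumes R: "multivariate_normal 0 ((*v) R) \<nu>" and k: "k > 0" and q: "q \<ge> 0"
  shows "multivariate_student k m ((q / real k) *\<^sub>R R)
     (distr (\<nu> \<Otimes>\<^sub>M chi_squared k) borel (\<lambda>(r, v). m + (sqrt q / sqrt v) *\<^sub>R r))"
  unfolding multivariate_student_def
proof (intro exI conjI)
  define a where "a = sqrt (q / real k)"
  have a2: "a * a = q / real k" using q by (simp add: a_def)
  have \<nu>: "prob_space \<nu>" "sets \<nu> = sets borel" and sym: "\<And>u v. u \<bullet> (R *v v) = (R *v u) \<bullet> v"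
    using R by (auto simp: multivariate_normal_def)
  note [measurable_cong] = \<nu>(2)
  have adj: "adjoint (\<lambda>r. a *\<^sub>R r) = (\<lambda>r::real ^ 'm. a *\<^sub>R r)"
    by (rule adjoint_unique) simp
  have Rs: "((q / real k) *\<^sub>R R) *v u = (q / real k) *\<^sub>R (R *v u)" for u
    by (simp add: scaleR_matrix_vector_assoc)
  show "multivariate_normal 0 (\<lambda>z. ((q / real k) *\<^sub>R R) *v z) (distr \<nu> borel (\<lambda>r. a *\<^sub>R r))"
  proof (rule multivariate_normal_linear_image[OF R])
    show "linear (\<lambda>r::real ^ 'm. a *\<^sub>R r)" by (rule linear_scale_self)
    show "linear (\<lambda>z. ((q / real k) *\<^sub>R R) *v z)" by (rule matrix_vector_mul_linear)
  qed (simp_all add: Rs sym adj matrix_vector_mult_scaleR a2 flip: mult.assoc)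
  interpret X: prob_space "chi_squared k" by (rule prob_space_chi_squared[OF k])
  have sq: "sqrt (real k / v) * a = sqrt q / sqrt v" for v
    using k by (simp add: a_def real_sqrt_divide)
  have pair: "distr \<nu> borel (\<lambda>r. a *\<^sub>R r) \<Otimes>\<^sub>M chi_squared k =
      distr (\<nu> \<Otimes>\<^sub>M chi_squared k) (borel \<Otimes>\<^sub>M borel) (\<lambda>(r, v). (a *\<^sub>R r, v))"
  proof -
    have id: "distr (chi_squared k) borel (\<lambda>v. v) = chi_squared k"
      by (rule distr_id2) simp
    have "sigma_finite_measure (distr (chi_squared k) borel (\<lambda>v. v))"
      unfolding id by unfold_locales
    from pair_measure_distr[OF _ _ this, of "\<lambda>r. a *\<^sub>R r" \<nu> borel] show ?thesis
      unfolding id by simp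
  qed
  show "distr (\<nu> \<Otimes>\<^sub>M chi_squared k) borel (\<lambda>(r, v). m + (sqrt q / sqrt v) *\<^sub>R r) =
      distr (distr \<nu> borel (\<lambda>r. a *\<^sub>R r) \<Otimes>\<^sub>M chi_squared k) borel
        (\<lambda>(z, v). m + sqrt (real k / v) *\<^sub>R z)"
    unfolding pair by (subst distr_distr) (auto simp: comp_def split_beta' sq)
qed

text \<open>
  The first marginal of \<open>Q\<close> is the image of \<open>D\<close> under \<open>Y\<close>, because each \<open>\<kappa> y\<close> has mass one. The left
  inverse \<open>J\<close> maps this marginal back to \<open>D\<close>, and a measure with a sigma-finite image is sigma-finite.
\<close>

lemma conditional_distribution_pushforward:
  fixes Q :: "('a::euclidean_space \<times> 'b::euclidean_space) measure" and Y :: "'z::euclidean_space \<Rightarrow> 'a"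
  assumes \<kappa>: "\<kappa> \<in> borel \<rightarrow>\<^sub>M prob_algebra borel"
    and D: "sigma_finite_measure D" "sets D = sets borel"
    and Y: "Y \<in> borel_measurable borel" and J: "J \<in> borel_measurable borel" "\<And>z. J (Y z) = z"
    and Qs: "sets Q = sets borel"
    and Q: "\<And>g. g \<in> borel_measurable borel \<Longrightarrow>
        (\<integral>\<^sup>+x. g x \<partial>Q) = (\<integral>\<^sup>+z. (\<integral>\<^sup>+y0. g (Y z, y0) \<partial>\<kappa> (Y z)) \<partial>D)"
  shows "sigma_finite_measure (distr Q borel fst)" "conditional_distribution Q \<kappa>"
proof -
  note [measurable] = Y J and [measurable_cong] = D(2)
  have Qs': "sets Q = sets (borel \<Otimes>\<^sub>M borel)" using Qs by (simp only: borel_prod)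
  have sp: "sets (\<kappa> y) = sets borel" "prob_space (\<kappa> y)" for y
    using measurable_space[OF \<kappa>, of y] by (auto simp: space_prob_algebra)
  have em: "(\<lambda>y. emeasure (\<kappa> y) B) \<in> borel_measurable borel" if "B \<in> sets borel" for B
    using measurable_emeasure_kernel[OF measurable_prob_algebraD[OF \<kappa>] that] .
  have rect: "emeasure Q (A \<times> B) = (\<integral>\<^sup>+z. emeasure (\<kappa> (Y z)) B * indicator A (Y z) \<partial>D)"
    if A: "A \<in> sets borel" and B: "B \<in> sets borel" for A B
  proof -
    have "A \<times> B \<in> sets (borel \<Otimes>\<^sub>M borel)" using A B by simp
    hence AB: "A \<times> B \<in> sets borel" by (simp only: borel_prod)
    have "emeasure Q (A \<times> B) = (\<integral>\<^sup>+x. indicator (A \<times> B) x \<partial>Q)"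
      using AB Qs by simp
    also have "\<dots> = (\<integral>\<^sup>+z. (\<integral>\<^sup>+y0. indicator (A \<times> B) (Y z, y0) \<partial>\<kappa> (Y z)) \<partial>D)"
      by (intro Q borel_measurable_indicator AB)
    also have "\<dots> = (\<integral>\<^sup>+z. emeasure (\<kappa> (Y z)) B * indicator A (Y z) \<partial>D)"
    proof (intro nn_integral_cong)
      fix z
      have "(\<integral>\<^sup>+y0. indicator (A \<times> B) (Y z, y0) \<partial>\<kappa> (Y z)) = (\<integral>\<^sup>+y0. indicator A (Y z) * indicator B y0 \<partial>\<kappa> (Y z))"
        by (intro nn_integral_cong) (auto simp: indicator_def)
      also have "\<dots> = indicator A (Y z) * emeasure (\<kappa> (Y z)) B"
        using B sp(1)[of "Y z"] by (subst nn_integral_cmult) auto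
      finally show "(\<integral>\<^sup>+y0. indicator (A \<times> B) (Y z, y0) \<partial>\<kappa> (Y z)) = emeasure (\<kappa> (Y z)) B * indicator A (Y z)"
        by (simp add: mult.commute)
    qed
    finally show ?thesis .
  qed
  have marg: "distr Q borel fst = distr D borel Y"
  proof (rule measure_eqI)
    fix A assume "A \<in> sets (distr Q borel fst)"
    hence A: "A \<in> sets borel" by simp
    have f: "fst \<in> borel_measurable Q" using measurable_cong_sets[OF Qs' refl] measurable_fst by blast
    have sQ: "space Q = UNIV" using sets_eq_imp_space_eq[OF Qs] by simp
    have "emeasure (distr Q borel fst) A = emeasure Q (A \<times> UNIV)"
      unfolding emeasure_distr[OF f A] by (rule arg_cong[where f = "emeasure Q"]) (auto simp: sQ)
    also have "\<dots> = (\<integral>\<^sup>+z. indicator A (Y z) \<partial>D)"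
    proof -
      have "emeasure (\<kappa> y) UNIV = 1" for y
        using prob_space.emeasure_space_1[OF sp(2)[of y]] sets_eq_imp_space_eq[OF sp(1)[of y]] by simp
      thus ?thesis using rect[OF A, of UNIV] by simp
    qed
    also have "\<dots> = (\<integral>\<^sup>+y. indicator A y \<partial>distr D borel Y)"
      using A by (subst nn_integral_distr) auto
    also have "\<dots> = emeasure (distr D borel Y) A"
      using A by simp
    finally show "emeasure (distr Q borel fst) A = emeasure (distr D borel Y) A" .
  qed simp
  have "distr (distr D borel Y) borel J = D"
    using D(2) by (subst distr_distr) (auto simp: comp_def J(2) intro!: distr_id2)
  thus "sigma_finite_measure (distr Q borel fst)"
    unfolding marg using D(1) by (intro sigma_finite_measure_distr[of _ borel J]) auto
  show "conditional_distribution Q \<kappa>"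
    unfolding conditional_distribution_def marg
    using rect em \<kappa> by (auto simp: nn_integral_distr)
qed

text \<open>
  For a fixed event the two kernels are densities of the same measure with respect to the sigma-finite marginal, so they
  agree almost everywhere. A countable generator closed under finite intersections, made from a countable
  base of the topology, collects the exceptional sets into one null set.
\<close>

lemma conditional_distribution_unique:
  fixes Q :: "('a::euclidean_space \<times> 'b::euclidean_space) measure"
  assumes fin: "sigma_finite_measure (distr Q borel fst)"
    and k1: "conditional_distribution Q \<kappa>1" and k2: "conditional_distribution Q \<kappa>2"
  shows "AE y in distr Q borel fst. \<kappa>1 y = \<kappa>2 y"
proof -
  interpret sigma_finite_measure "distr Q borel fst" by fact
  obtain U :: "'b set set" where U: "countable U" "topological_basis U"
    using ex_countable_basis by blast
  \<comment> \<open>The empty family contributes \<open>UNIV\<close>, which later serves as the cover of the whole space.\<close>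
  define E where "E = (\<lambda>F. \<Inter>F) ` {F. F \<subseteq> U \<and> finite F}"
  have "countable E"
    unfolding E_def using countable_Collect_finite_subset[OF U(1)] by (simp add: conj_commute)
  have stable: "Int_stable E"
    unfolding E_def Int_stable_def by (auto simp flip: Inter_Un_distrib intro!: imageI)
  have E_sets: "X \<in> sets borel" if "X \<in> E" for X
    using that U(2) unfolding E_def by (auto intro!: borel_open open_Inter intro: topological_basis_open)
  have sets_E: "sets borel = sigma_sets UNIV E"
  proof
    have "U \<subseteq> E" unfolding E_def by (auto intro!: image_eqI[of _ _ "{x}" for x])
    hence "sigma_sets UNIV U \<subseteq> sigma_sets UNIV E" by (rule sigma_sets_mono')
    thus "sets borel \<subseteq> sigma_sets UNIV E" by (simp add: borel_eq_countable_basis[OF U])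
    show "sigma_sets UNIV E \<subseteq> sets borel"
      using E_sets sets.sigma_sets_subset[of E borel] by auto
  qed
  have meas: "\<kappa>1 \<in> borel \<rightarrow>\<^sub>M prob_algebra borel" "\<kappa>2 \<in> borel \<rightarrow>\<^sub>M prob_algebra borel"
    using k1 k2 by (auto simp: conditional_distribution_def)
  have em: "(\<lambda>y. emeasure (\<kappa> y) X) \<in> borel_measurable borel"
    if "\<kappa> \<in> borel \<rightarrow>\<^sub>M prob_algebra borel" "X \<in> sets borel" for \<kappa> :: "'a \<Rightarrow> 'b measure" and X
    using measurable_emeasure_kernel[OF measurable_prob_algebraD[OF that(1)] that(2)] .
  have "AE y in distr Q borel fst. emeasure (\<kappa>1 y) X = emeasure (\<kappa>2 y) X" if X: "X \<in> sets borel" for X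
  proof (rule density_unique)
    show "(\<lambda>y. emeasure (\<kappa>1 y) X) \<in> borel_measurable (distr Q borel fst)"
        "(\<lambda>y. emeasure (\<kappa>2 y) X) \<in> borel_measurable (distr Q borel fst)"
      using em meas X by auto
    show "density (distr Q borel fst) (\<lambda>y. emeasure (\<kappa>1 y) X) = density (distr Q borel fst) (\<lambda>y. emeasure (\<kappa>2 y) X)"
    proof (rule measure_eqI)
      fix A assume "A \<in> sets (density (distr Q borel fst) (\<lambda>y. emeasure (\<kappa>1 y) X))"
      hence A: "A \<in> sets borel" by simp
      show "emeasure (density (distr Q borel fst) (\<lambda>y. emeasure (\<kappa>1 y) X)) A =
          emeasure (density (distr Q borel fst) (\<lambda>y. emeasure (\<kappa>2 y) X)) A"
        using k1 k2 A X em meas by (simp add: emeasure_density conditional_distribution_def)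
    qed simp
  qed
  hence "AE y in distr Q borel fst. \<forall>X\<in>E. emeasure (\<kappa>1 y) X = emeasure (\<kappa>2 y) X"
    using \<open>countable E\<close> E_sets by (subst AE_ball_countable) auto
  thus ?thesis
  proof (eventually_elim)
    case (elim y)
    have s: "sets (\<kappa>1 y) = sets borel" "sets (\<kappa>2 y) = sets borel" and p: "prob_space (\<kappa>1 y)"
      using measurable_space[OF meas(1), of y] measurable_space[OF meas(2), of y]
      by (auto simp: space_prob_algebra)
    interpret prob_space "\<kappa>1 y" by fact
    show ?case
    proof (rule measure_eqI_generator_eq[OF stable, where \<Omega> = UNIV and A = "\<lambda>_. UNIV"])
      show "range (\<lambda>_::nat. UNIV) \<subseteq> E" unfolding E_def by (auto intro!: image_eqI[of _ _ "{}"])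
    qed (use elim s sets_E in auto)
  qed
qed

section \<open>The predictive distribution\<close>

theorem corollary3:
  fixes H :: "real ^ 'p ^ 'n" and H00 :: "real ^ 'p ^ 'm"
    and \<Sigma> :: "real ^ 'n ^ 'n" and \<Sigma>0 :: "real ^ 'n ^ 'm" and \<Sigma>00 :: "real ^ 'm ^ 'm"
    and P :: "real ^ 'p ^ 'n" and W :: "real ^ 'q ^ 'n"
    and H0 :: "real ^ 'p ^ 'm" and S00 :: "real ^ 'm ^ 'm" and S0W :: "real ^ 'q ^ 'm"
    and K :: "real ^ 'q ^ 'q"
    and law :: "real ^ 'p \<Rightarrow> real \<Rightarrow> ((real ^ 'n) \<times> (real ^ 'm)) measure"
    and c :: real and Q :: "((real ^ 'n) \<times> (real ^ 'm)) measure"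
    and location :: "real ^ 'n \<Rightarrow> real ^ 'm" and scale :: "real ^ 'n \<Rightarrow> real ^ 'm ^ 'm"
  assumes dims: "CARD('p) < CARD('n)" "CARD('q) = CARD('n) - CARD('p)"
    and rank_H: "rank H = CARD('p)"
    and nonsingular: "invertible \<Sigma>"
    and P: "rank P = CARD('p)" "span (columns P) = span (columns H)"
    and W: "rank W = CARD('q)" "span (columns W) = orthogonal_comp (span (columns H))"
    and PW: "P ** transpose P + W ** transpose W = mat 1"
    and H0: "H0 = H00 ** matrix_inv (transpose P ** H)"
    and S00: "S00 = \<Sigma>00 + H0 ** transpose P ** \<Sigma> ** P ** transpose H0
                 - H0 ** transpose P ** transpose \<Sigma>0 - \<Sigma>0 ** P ** transpose H0"
    and S0W: "S0W = (H0 ** transpose P ** \<Sigma> - \<Sigma>0) ** W"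
    and K: "K = matrix_inv (transpose W ** \<Sigma> ** W)"
    and location: "\<And>y. location y =
           H0 *v (transpose P *v y) - S0W *v (K *v (transpose W *v y))"
    and scale: "\<And>y. scale y =
           ((transpose W *v y) \<bullet> (K *v (transpose W *v y)) / real (CARD('n) - CARD('p)))
             *\<^sub>R (S00 - S0W ** K ** transpose S0W)"
    and gaussian: "\<And>\<beta> s. s > 0 \<Longrightarrow>
           multivariate_normal (H *v \<beta>, H00 *v \<beta>)
             (\<lambda>(u, v). (s *\<^sub>R (\<Sigma> *v u + transpose \<Sigma>0 *v v), s *\<^sub>R (\<Sigma>0 *v u + \<Sigma>00 *v v)))
             (law \<beta> s)"
    and c: "c > 0"
    and Q: "Q = Giry_Monad.bind (reference_prior c) (\<lambda>(\<beta>, s). law \<beta> s)"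
  shows "sigma_finite_measure (distr Q borel fst) \<and>
         (\<exists>\<kappa>. conditional_distribution Q \<kappa> \<and>
           (\<forall>y. multivariate_student (CARD('n) - CARD('p)) (location y) (scale y) (\<kappa> y))) \<and>
         (\<forall>\<kappa>. conditional_distribution Q \<kappa> \<longrightarrow>
           (AE y in distr Q borel fst.
              multivariate_student (CARD('n) - CARD('p)) (location y) (scale y) (\<kappa> y)))"
proof -
  note assoc = matrix_vector_mul_assoc[symmetric]
  let ?C = "block_operator \<Sigma> \<Sigma>0 \<Sigma>00"
  define k where "k = CARD('q)"
  have k: "k > 0" "CARD('n) - CARD('p) = k" "DIM(real ^ 'q) = k" using dims by (simp_all add: k_def)
  note frame = complementary_frame[OF rank_H P W PW]
  have frame_v: "transpose W *v (H *v x) = 0" "transpose P *v (W *v u) = 0" "transpose W *v (W *v u) = u"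
      "P *v (transpose P *v (H *v x)) = H *v x" for x u
    using frame by (simp_all add: matrix_vector_mul_assoc matrix_mul_assoc)
  have resolve: "P *v (transpose P *v x) + W *v (transpose W *v x) = x" for x
    using arg_cong[OF PW, of "\<lambda>A. A *v x"] by (simp add: matrix_vector_mul_assoc matrix_vector_mult_add_rdistrib)
  define J where "J = matrix_inv (transpose P ** H)"
  have J1: "transpose P *v (H *v (J *v x)) = x" and J2: "J *v (transpose P *v (H *v x)) = x" for x
    using matrix_inv_cancel[OF frame(5), of x] by (simp_all add: J_def assoc)

  define L where "L = law 0 1"
  have L: "multivariate_normal 0 ?C L"
    using gaussian[of 1 0] by (simp add: L_def zero_prod_def)
  have L': "prob_space L" "sets L = sets borel" and Csym: "\<And>u v. u \<bullet> ?C v = ?C u \<bullet> v"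
    using L unfolding multivariate_normal_def by blast+
  note Cpos = multivariate_normal_covariance_nonneg[OF L]
  note sym = block_operator_symmetric_imp[OF Csym]
  have [measurable_cong]: "sets L = sets (borel \<Otimes>\<^sub>M borel)" using L'(2) by (simp only: borel_prod)
  have \<Sigma>_pos: "0 < x \<bullet> (\<Sigma> *v x)" if "x \<noteq> 0" for x
    using psd_invertible_imp_pos[OF nonsingular sym(1) _ that] Cpos[of "(_, 0)"] by simp
  define G where "G = transpose W ** \<Sigma> ** W"
  have G_sym: "transpose G = G" by (simp add: G_def matrix_transpose_mul sym matrix_mul_assoc)
  have G_pos: "0 < x \<bullet> (G *v x)" if "x \<noteq> 0" for x
  proof -
    have "W *v x \<noteq> 0" using frame_v(3)[of x] that by auto
    thus ?thesis using \<Sigma>_pos[of "W *v x"]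
      by (simp add: G_def assoc inner_matrix_mult[of x "transpose W"])
  qed
  obtain N :: "real ^ 'q ^ 'q" where GN: "matrix_inv G = N ** transpose N" and NGN: "transpose N ** (G ** N) = mat 1"
    by (rule ex_matrix_whitening[OF G_sym G_pos])
  have KN: "K = N ** transpose N" unfolding K GN[unfolded G_def] ..
  have NGN_v: "transpose N *v (G *v (N *v x)) = x" for x
    using arg_cong[OF NGN, of "\<lambda>A. A *v x"] by (simp add: assoc)
  have "(G ** N) ** transpose N = mat 1" using NGN matrix_left_right_inverse by blast
  hence GNN_v: "G *v (N *v (transpose N *v x)) = x" for x
    by (metis matrix_vector_mul_assoc matrix_vector_mul_lid)

  \<comment> \<open>\<open>D \<epsilon>\<close> adds to \<open>A \<epsilon>\<close> the regression of \<open>\<epsilon>0 - A \<epsilon>\<close> on \<open>W\<^sup>T \<epsilon>\<close>; \<open>R\<close> is the covariance of the error.\<close>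
  define A where "A = H0 ** transpose P"
  define D where "D = A - S0W ** K ** transpose W"
  define R where "R = S00 - S0W ** K ** transpose S0W"
  have S: "S0W = (A ** \<Sigma> - \<Sigma>0) ** W" by (simp add: S0W A_def)
  have R_eq: "R = (\<Sigma>00 + A ** \<Sigma> ** transpose A - A ** transpose \<Sigma>0 - \<Sigma>0 ** transpose A)
        - S0W ** (N ** transpose N) ** transpose S0W"
    by (simp add: R_def S00 A_def matrix_transpose_mul matrix_mul_assoc KN)
  have D_eq: "D = A - S0W ** (N ** transpose N) ** transpose W" by (simp add: D_def KN)
  have A_v: "A *v (H *v x) = H00 *v x" for x
    using J2[of x] by (simp add: A_def H0 J_def assoc)
  have A_P: "A *v x = H00 *v (J *v (transpose P *v x))" for x
    by (simp add: A_def H0 J_def assoc)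
  define \<nu> where "\<nu> = distr L borel (\<lambda>e. snd e - D *v fst e)"
  note decomp = gaussian_residual_decomposition[OF L NGN[unfolded G_def matrix_mul_assoc[of _ N]] S D_eq R_eq, folded \<nu>_def]
  have \<nu>: "prob_space \<nu>" "sets \<nu> = sets borel" using decomp(1) by (auto simp: multivariate_normal_def)
  note [measurable_cong] = \<nu>(2)

  have mv[measurable]: "(*v) B \<in> borel_measurable borel" for B :: "real ^ 'a::finite ^ 'b::finite"
    by (intro borel_measurable_continuous_onI linear_continuous_on linear_conv_bounded_linear[THEN iffD1] matrix_vector_mul_linear)

  \<comment> \<open>Coordinates \<open>(\<beta>, x)\<close> for the observed vector; \<open>G N\<close> inverts \<open>N\<^sup>T\<close>, hence \<open>x = N\<^sup>T W\<^sup>T y\<close>.\<close>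
  define Y where "Y = (\<lambda>(\<beta>, x). H *v \<beta> + W *v (G *v (N *v x)))"
  define Y' where "Y' y = (J *v (transpose P *v y), transpose N *v (transpose W *v y))" for y
  have Y'Y: "Y' (Y z) = z" for z
    by (cases z) (simp add: Y_def Y'_def matrix_vector_right_distrib frame_v J2 NGN_v)
  have Ym: "Y \<in> borel_measurable borel"
    unfolding Y_def borel_prod[symmetric] by measurable
  have Y'm: "Y' \<in> borel_measurable borel" unfolding Y'_def by measurable
  have loc_Y: "location (Y (\<beta>, x)) = H00 *v \<beta> - S0W *v (N *v x)" for \<beta> x
  proof -
    have "A *v (W *v u) = 0" for u by (simp add: A_def assoc frame_v)
    hence "location (Y (\<beta>, x)) = H00 *v \<beta> - S0W *v (N *v (transpose N *v (G *v (N *v x))))"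
      using A_v[of \<beta>]
      by (simp add: location KN Y_def A_def matrix_vector_right_distrib frame_v assoc)
    thus ?thesis by (simp add: NGN_v)
  qed
  \<comment> \<open>Defined for every \<open>y\<close>; where \<open>W\<^sup>T y = 0\<close> it is the point mass at \<open>location y\<close>.\<close>
  define \<kappa> where "\<kappa> y = distr (\<nu> \<Otimes>\<^sub>M chi_squared k) borel
     (\<lambda>(r, v). location y + (norm (transpose N *v (transpose W *v y)) / sqrt v) *\<^sub>R r)" for y
  have q: "(transpose W *v y) \<bullet> (K *v (transpose W *v y)) = (norm (transpose N *v (transpose W *v y)))\<^sup>2" for y
    by (simp add: KN assoc inner_matrix_mult[of _ N] power2_norm_eq_inner)
  have student: "multivariate_student (CARD('n) - CARD('p)) (location y) (scale y) (\<kappa> y)" for y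
    using multivariate_student_scale_mixture[OF decomp(1) k(1), of "(norm (transpose N *v (transpose W *v y)))\<^sup>2" "location y"]
    by (simp add: \<kappa>_def scale k(2) q R_def)
  have loc_m[measurable]: "location \<in> borel_measurable borel"
    unfolding location[abs_def] by measurable
  interpret \<nu>: prob_space \<nu> by fact
  interpret X: prob_space "chi_squared k" by (rule prob_space_chi_squared[OF k(1)])
  interpret \<nu>X: pair_prob_space \<nu> "chi_squared k" ..
  have \<kappa>m: "\<kappa> \<in> borel \<rightarrow>\<^sub>M prob_algebra borel"
    unfolding \<kappa>_def
  proof (rule measurable_distr_prob_space2)
    show "(\<lambda>y. \<nu> \<Otimes>\<^sub>M chi_squared k) \<in> borel \<rightarrow>\<^sub>M prob_algebra (borel \<Otimes>\<^sub>M borel)"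
      using \<nu>X.prob_space_axioms sets_pair_measure_cong[OF \<nu>(2) sets_chi_squared[of k]]
      by (intro measurable_const) (simp add: space_prob_algebra)
  qed measurable

  \<comment> \<open>At \<open>x = 0\<close> the power with base zero takes the value 0, so \<open>f\<close> is finite everywhere.\<close>
  define f where "f = (\<lambda>(\<beta>::real ^ 'p, x::real ^ 'q). ennreal (c * radial_const k * norm x powr (- real k)))"
  have fm: "f \<in> borel_measurable borel" unfolding f_def borel_prod[symmetric] by measurable
  have sf: "sigma_finite_measure (density lborel f)"
    by (subst sigma_finite_measure.sigma_finite_iff_density_finite[OF sigma_finite_lborel])
       (use fm in \<open>auto simp: f_def\<close>)

  have law: "law \<beta> s = distr L borel (\<lambda>e. (H *v \<beta>, H00 *v \<beta>) + sqrt s *\<^sub>R e)" if "s > 0" for \<beta> s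
  proof (rule location_scale_law[OF L _ that])
    have "(\<lambda>x. s *\<^sub>R ?C x) = (\<lambda>(u, v). (s *\<^sub>R (\<Sigma> *v u + transpose \<Sigma>0 *v v), s *\<^sub>R (\<Sigma>0 *v u + \<Sigma>00 *v v)))"
      by (auto simp: fun_eq_iff)
    thus "multivariate_normal (H *v \<beta>, H00 *v \<beta>) (\<lambda>x. s *\<^sub>R ?C x) (law \<beta> s)"
      using gaussian[OF that, of \<beta>] by simp
  qed
  have prior: "space (reference_prior c :: ((real ^ 'p) \<times> real) measure) = UNIV \<times> {0<..}"
    "sets (reference_prior c :: ((real ^ 'p) \<times> real) measure) = sets (restrict_space borel (UNIV \<times> {0<..}))"
    by (auto simp: reference_prior_def space_restrict_space intro!: sets_restrict_space_cong)
  have law_m: "(\<lambda>(\<beta>, s). law \<beta> s) \<in> reference_prior c \<rightarrow>\<^sub>M subprob_algebra borel"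
  proof -
    have "(\<lambda>z::(real ^ 'p) \<times> real. distr L borel (\<lambda>e. (H *v fst z, H00 *v fst z) + sqrt (snd z) *\<^sub>R e))
        \<in> borel \<Otimes>\<^sub>M borel \<rightarrow>\<^sub>M prob_algebra borel"
    proof (rule measurable_distr_prob_space2)
      show "(\<lambda>z. L) \<in> borel \<Otimes>\<^sub>M borel \<rightarrow>\<^sub>M prob_algebra borel"
        using L' by (intro measurable_const) (simp add: space_prob_algebra)
      have "(\<lambda>z. (H *v fst (fst z), H00 *v fst (fst z)) + sqrt (snd (fst z)) *\<^sub>R snd z)
          \<in> (borel \<Otimes>\<^sub>M borel) \<Otimes>\<^sub>M borel \<rightarrow>\<^sub>M borel"
        by measurable
      thus "(\<lambda>(z, e). (H *v fst z, H00 *v fst z) + sqrt (snd z) *\<^sub>R e) \<in> (borel \<Otimes>\<^sub>M borel) \<Otimes>\<^sub>M borel \<rightarrow>\<^sub>M borel"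
        by (simp add: split_beta')
    qed
    hence "(\<lambda>z::(real ^ 'p) \<times> real. distr L borel (\<lambda>e. (H *v fst z, H00 *v fst z) + sqrt (snd z) *\<^sub>R e))
        \<in> reference_prior c \<rightarrow>\<^sub>M subprob_algebra borel"
      unfolding borel_prod measurable_cong_sets[OF prior(2) refl]
      by (intro measurable_restrict_space1 measurable_prob_algebraD)
    thus ?thesis
      by (rule measurable_cong[THEN iffD1, rotated]) (auto simp: prior law)
  qed
  have Qs: "sets Q = sets borel"
    unfolding Q by (rule sets_bind[OF sets_kernel[OF law_m]]) (auto simp: prior intro: exI[of _ 1])

  have disint: "(\<integral>\<^sup>+x. g x \<partial>Q) = (\<integral>\<^sup>+z. (\<integral>\<^sup>+y0. g (Y z, y0) \<partial>\<kappa> (Y z)) \<partial>density lborel f)"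
    if g: "g \<in> borel_measurable borel" for g
  proof -
    have gm[measurable]: "g \<in> borel_measurable (borel \<Otimes>\<^sub>M borel)" using g by (simp only: borel_prod)
    \<comment> \<open>The integrand in the coordinates \<open>(\<beta>, x)\<close> and the scaled prediction error \<open>r = sqrt s \<rho>\<close>.\<close>
    define h where "h = (\<lambda>(\<beta>, x, r). g (Y (\<beta>, x), H00 *v \<beta> - S0W *v (N *v x) + r))"
    have hm: "h \<in> borel_measurable borel"
      unfolding h_def borel_prod[symmetric] Y_def by measurable
    define \<tau> where "\<tau> e = J *v (transpose P *v fst e)" for e :: "(real ^ 'n) \<times> (real ^ 'm)"
    define \<xi> where "\<xi> e = transpose N *v (transpose W *v fst e)" for e :: "(real ^ 'n) \<times> (real ^ 'm)"
    define \<rho> where "\<rho> e = snd e - D *v fst e" for e :: "(real ^ 'n) \<times> (real ^ 'm)"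
    have \<tau>m: "\<tau> \<in> borel_measurable L" and \<xi>m: "\<xi> \<in> borel_measurable L" and \<rho>m: "\<rho> \<in> borel_measurable L"
      unfolding \<tau>_def \<xi>_def \<rho>_def by measurable
    \<comment> \<open>With \<open>t = sqrt s\<close>: the noise moves \<open>\<beta>\<close> by \<open>t \<tau>\<close> and otherwise enters only through \<open>x = t \<xi>\<close> and \<open>r = t \<rho>\<close>.\<close>
    have split: "(H *v \<beta>, H00 *v \<beta>) + t *\<^sub>R e =
        (Y (\<beta> + t *\<^sub>R \<tau> e, t *\<^sub>R \<xi> e), H00 *v (\<beta> + t *\<^sub>R \<tau> e) - S0W *v (N *v (t *\<^sub>R \<xi> e)) + t *\<^sub>R \<rho> e)"
      for \<beta> t e
    proof -
      have "H *v \<tau> e = P *v (transpose P *v (H *v \<tau> e))" by (simp add: frame_v)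
      also have "\<dots> = P *v (transpose P *v fst e)" by (simp add: \<tau>_def J1)
      finally have "H *v \<tau> e + W *v (G *v (N *v \<xi> e)) = fst e"
        by (simp add: \<xi>_def GNN_v resolve)
      moreover have "H00 *v \<tau> e - S0W *v (N *v \<xi> e) + \<rho> e = snd e"
        by (simp add: \<rho>_def D_eq \<tau>_def \<xi>_def A_P assoc matrix_vector_mult_diff_rdistrib)
      ultimately show ?thesis
        by (cases e) (simp add: Y_def matrix_vector_right_distrib matrix_vector_mult_scaleR algebra_simps
            flip: scaleR_add_right scaleR_diff_right)
    qed
    have "(\<integral>\<^sup>+x. g x \<partial>Q) = (\<integral>\<^sup>+z. (\<integral>\<^sup>+x. g x \<partial>(case z of (\<beta>, s) \<Rightarrow> law \<beta> s)) \<partial>reference_prior c)"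
      unfolding Q by (rule nn_integral_bind[OF g law_m])
    also have "\<dots> = (\<integral>\<^sup>+(\<beta>, s). (\<integral>\<^sup>+e. h (\<beta> + sqrt s *\<^sub>R \<tau> e, sqrt s *\<^sub>R \<xi> e, sqrt s *\<^sub>R \<rho> e) \<partial>L) \<partial>reference_prior c)"
    proof (intro nn_integral_cong, clarify)
      fix \<beta> :: "real ^ 'p" and s :: real
      assume "(\<beta>, s) \<in> space (reference_prior c)"
      hence s: "s > 0" by (simp add: prior)
      have "(\<integral>\<^sup>+x. g x \<partial>law \<beta> s) = (\<integral>\<^sup>+e. g ((H *v \<beta>, H00 *v \<beta>) + sqrt s *\<^sub>R e) \<partial>L)"
        unfolding law[OF s] using g L'(2)
        by (intro nn_integral_distr) (auto simp: measurable_cong_sets[OF L'(2) refl])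
      thus "(\<integral>\<^sup>+x. g x \<partial>law \<beta> s) =
          (\<integral>\<^sup>+e. h (\<beta> + sqrt s *\<^sub>R \<tau> e, sqrt s *\<^sub>R \<xi> e, sqrt s *\<^sub>R \<rho> e) \<partial>L)"
        by (simp only: split h_def prod.case)
    qed
    also have "\<dots> = (\<integral>\<^sup>+(\<beta>, x). ennreal (c * radial_const k * norm x powr (- real k)) *
       (\<integral>\<^sup>+(r, v). h (\<beta>, x, (norm x / sqrt v) *\<^sub>R r) \<partial>(\<nu> \<Otimes>\<^sub>M chi_squared k)) \<partial>lborel)"
      using nn_integral_location_scale_mixture[OF L'(1) \<nu> \<tau>m \<xi>m \<rho>m hm _ c] decomp(2)
      by (simp add: \<xi>_def[abs_def] \<rho>_def[abs_def] k_def)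
    also have "\<dots> = (\<integral>\<^sup>+z. f z * (\<integral>\<^sup>+y0. g (Y z, y0) \<partial>\<kappa> (Y z)) \<partial>lborel)"
    proof (intro nn_integral_cong, clarify)
      fix \<beta> :: "real ^ 'p" and x :: "real ^ 'q"
      have n: "norm (transpose N *v (transpose W *v Y (\<beta>, x))) = norm x"
        using Y'Y[of "(\<beta>, x)"] by (simp add: Y'_def)
      have "(\<integral>\<^sup>+y0. g (Y (\<beta>, x), y0) \<partial>\<kappa> (Y (\<beta>, x))) =
          (\<integral>\<^sup>+z. g (Y (\<beta>, x), case z of (r, v) \<Rightarrow> H00 *v \<beta> - S0W *v (N *v x) + (norm x / sqrt v) *\<^sub>R r) \<partial>(\<nu> \<Otimes>\<^sub>M chi_squared k))"
        unfolding \<kappa>_def n loc_Y by (intro nn_integral_distr) measurable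
      thus "ennreal (c * radial_const k * norm x powr (- real k)) *
         (\<integral>\<^sup>+(r, v). h (\<beta>, x, (norm x / sqrt v) *\<^sub>R r) \<partial>(\<nu> \<Otimes>\<^sub>M chi_squared k)) =
         f (\<beta>, x) * (\<integral>\<^sup>+y0. g (Y (\<beta>, x), y0) \<partial>\<kappa> (Y (\<beta>, x)))"
        by (simp add: f_def h_def split_beta')
    qed
    also have "\<dots> = (\<integral>\<^sup>+z. (\<integral>\<^sup>+y0. g (Y z, y0) \<partial>\<kappa> (Y z)) \<partial>density lborel f)"
    proof (subst nn_integral_density)
      have "(\<lambda>y. \<integral>\<^sup>+y0. g (y, y0) \<partial>\<kappa> y) \<in> borel_measurable borel"
        by (rule nn_integral_measurable_subprob_algebra2[OF _ measurable_prob_algebraD[OF \<kappa>m]]) measurable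
      thus "(\<lambda>z. \<integral>\<^sup>+y0. g (Y z, y0) \<partial>\<kappa> (Y z)) \<in> borel_measurable lborel"
        using measurable_compose[OF Ym] by simp
    qed (use fm in auto)
    finally show ?thesis .
  qed
  have fin: "sigma_finite_measure (distr Q borel fst)" and cond: "conditional_distribution Q \<kappa>"
    using conditional_distribution_pushforward[OF \<kappa>m sf _ Ym Y'm Y'Y Qs disint] by auto
  moreover have "AE y in distr Q borel fst. multivariate_student (CARD('n) - CARD('p)) (location y) (scale y) (\<kappa>' y)"
    if "conditional_distribution Q \<kappa>'" for \<kappa>'
    using conditional_distribution_unique[OF fin cond that] by eventually_elim (metis student)
  ultimately show ?thesis using student by blast
qed

end
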